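(* Let $d\ge 1$ and let $p,q$ be monic polynomials of degree $d$ with complex coefficients. Then for every $n=1,\dots,d$, \[ \kappa_n^d(p \boxtimes_d q )=\frac{(-1)^{n-1}}{d^{n+1} (n-1)!} \sum_{\substack{ \sigma, \tau\in P(n) \\ \sigma\vee \tau=1_n }} d^{|\sigma|+|\tau|}\mu(0_n,\sigma)\mu(0_n,\tau) \kappa_\sigma^d(p ) \kappa^d_\tau(q ) \] and \[ m_n(p \boxtimes_d q )=\frac{(-1)^{n-1}}{d^{n+1} (n-1)!} \sum_{\substack{ \sigma, \tau\in P(n) \\ \sigma\vee \tau=1_n }} d^{|\sigma|+|\tau|}\mu(0_n,\sigma)\mu(0_n,\tau) \kappa_\sigma^d(p ) m_\tau(q ). \]
   Context: For a monic polynomial $p$ of degree $d$ with roots $\lambda_1,\dots,\lambda_d$ write $p(x)=\sum_{i=0}^d (-1)^i a_i^p x^{d-i}$, so $a_0^p=1$ and $a_i^p$ is the $i$-th elementary symmetric polynomial of the roots. The moments of $p$ are $m_n(p)=\frac1d\sum_{i=1}^d\lambda_i^n$. The finite free multiplicative convolution $p\boxtimes_d q$ is the monic polynomial of degree $d$ with $a_k^{p\boxtimes_d q}=a_k^pa_k^q/\binom{d}{k}$ for $k=0,\dots,d$. Let $(d)_k=d(d-1)\cdots(d-k+1)$. $P(n)$ is the lattice of set partitions of $\{1,\dots,n\}$ ordered by refinement ($\pi\le\sigma$ if every block of $\pi$ is contained in a block of $\sigma$), with minimum $0_n$ (all singletons), maximum $1_n$ (one block) and join $\vee$; $|\pi|$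 denotes the number of blocks of $\pi$, and $\mu$ is the Möbius function of $P(n)$, explicitly $\mu(0_n,\pi)=(-1)^{n-|\pi|}\prod_{V\in\pi}(|V|-1)!$. For a sequence $(u_j)$ and $\pi\in P(n)$ set $u_\pi=\prod_{V\in\pi}u_{|V|}$; for $\pi\in P(n)$ also set $a^p_\pi=\prod_{V\in\pi}a^p_{|V|}$, $N!_\pi=\prod_{V\in\pi}|V|!$ and $(d)_\pi=\prod_{V\in\pi}(d)_{|V|}$. The finite free cumulants of $p$ are defined for $n=1,\dots,d$ by \[\kappa_n^d(p)=\frac{(-d)^n}{d(n-1)!}\sum_{\pi\in P(n)}(-1)^{|\pi|}\frac{N!_\pi\, a_\pi^p\,(|\pi|-1)!}{(d)_\pi},\] and $\kappa^d_\sigma(p)=\prod_{V\in\sigma}\kappa^d_{|V|}(p)$, $m_\tau(q)=\prod_{V\in\tau}m_{|V|}(q)$. *)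

theory Defs
  imports
    "HOL-Library.Disjoint_Sets"
    "HOL-Computational_Algebra.Computational_Algebra"
begin

section \<open>The partition lattice\<close>

definition set_partitions :: "nat \<Rightarrow> nat set set set" where
  "set_partitions n = {\<pi>. partition_on {1..n} \<pi>}"

definition bot_partition :: "nat \<Rightarrow> nat set set" where
  "bot_partition n = (\<lambda>i. {i}) ` {1..n}"

text \<open>Only meant for \<open>n \<ge> 1\<close>: the sole partition of the empty set is \<open>{}\<close>.\<close>

definition top_partition :: "nat \<Rightarrow> nat set set" where
  "top_partition n = {{1..n}}"

text \<open>\<^term>\<open>refines A \<pi> \<sigma>\<close> includes that \<open>\<pi>\<close> and \<open>\<sigma>\<close> are partitions of \<open>A\<close>. The join is the
  least upper bound for this order; its existence is \<open>is_partition_join_partition_join\<close> below.\<close>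

definition is_partition_join :: "nat \<Rightarrow> nat set set \<Rightarrow> nat set set \<Rightarrow> nat set set \<Rightarrow> bool" where
  "is_partition_join n \<sigma> \<tau> \<rho> \<longleftrightarrow>
     refines {1..n} \<sigma> \<rho> \<and> refines {1..n} \<tau> \<rho> \<and>
     (\<forall>\<rho>'. refines {1..n} \<sigma> \<rho>' \<and> refines {1..n} \<tau> \<rho>' \<longrightarrow> refines {1..n} \<rho> \<rho>')"

definition partition_join :: "nat \<Rightarrow> nat set set \<Rightarrow> nat set set \<Rightarrow> nat set set" where
  "partition_join n \<sigma> \<tau> = (THE \<rho>. is_partition_join n \<sigma> \<tau> \<rho>)"

lemma is_partition_join_unique:
  "is_partition_join n \<sigma> \<tau> \<rho> \<Longrightarrow> is_partition_join n \<sigma> \<tau> \<rho>' \<Longrightarrow> \<rho> = \<rho>'"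
  unfolding is_partition_join_def by (meson refines_asym)

lemma is_partition_join_partition_join:
  assumes "\<sigma> \<in> set_partitions n" "\<tau> \<in> set_partitions n"
  shows "is_partition_join n \<sigma> \<tau> (partition_join n \<sigma> \<tau>)"
proof -
  define U where "U = {\<rho>. refines {1..n} \<sigma> \<rho> \<and> refines {1..n} \<tau> \<rho>}"
  have part: "partition_on {1..n} \<rho>" if "\<rho> \<in> U" for \<rho>
    using that by (auto simp: U_def refines_def)
  have nonempty: "U \<noteq> {}"
  proof (cases "n = 0")
    case True
    then have "\<sigma> = {}" "\<tau> = {}"
      using assms by (simp_all add: set_partitions_def partition_on_empty)
    then have "{} \<in> U"
      using True by (simp add: U_def refines_def partition_on_empty)
    then show ?thesis by blast
  next
    case False
    have "refines {1..n} \<pi> {{1..n}}" if "\<pi> \<in> set_partitions n" for \<pi>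
    proof -
      have "partition_on {1..n} \<pi>"
        using that by (simp add: set_partitions_def)
      moreover have "partition_on {1..n} {{1..n}}"
        using False by (intro partition_on_space) simp
      moreover have "X \<subseteq> {1..n}" if "X \<in> \<pi>" for X
        using that partition_onD1[OF \<open>partition_on {1..n} \<pi>\<close>] by blast
      ultimately show ?thesis
        unfolding refines_def by blast
    qed
    then have "{{1..n}} \<in> U"
      using assms unfolding U_def by blast
    then show ?thesis by blast
  qed
  have join: "is_partition_join n \<sigma> \<tau> (common_refinement U)"
    unfolding is_partition_join_def
  proof (intro conjI allI impI)
    show "refines {1..n} \<sigma> (common_refinement U)"
      using assms
      by (intro common_refinement_coarsest[OF part _ _ nonempty]) (simp_all add: U_def set_partitions_def)
    show "refines {1..n} \<tau> (common_refinement U)"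
      using assms
      by (intro common_refinement_coarsest[OF part _ _ nonempty]) (simp_all add: U_def set_partitions_def)
    fix \<rho>' assume "refines {1..n} \<sigma> \<rho>' \<and> refines {1..n} \<tau> \<rho>'"
    then have "\<rho>' \<in> U" by (simp add: U_def)
    then show "refines {1..n} (common_refinement U) \<rho>'"
      using refines_common_refinement[of U "{1..n}" \<rho>'] part by blast
  qed
  show ?thesis
    unfolding partition_join_def using join
    by (rule theI[where P = "is_partition_join n \<sigma> \<tau>"]) (rule is_partition_join_unique[OF _ join])
qed

text \<open>The Moebius function of the partition lattice, by its defining recursion
  \<open>\<mu>(\<sigma>,\<sigma>) = 1\<close> and \<open>\<mu>(\<sigma>,\<pi>) = - (\<Sum>\<sigma> \<le> \<rho> < \<pi>. \<mu>(\<sigma>,\<rho>))\<close> for \<open>\<sigma> < \<pi>\<close>.\<close>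

function moebius_partition :: "nat \<Rightarrow> nat set set \<Rightarrow> nat set set \<Rightarrow> int" where
  "moebius_partition n \<sigma> \<pi> =
     (if \<not> refines {1..n} \<sigma> \<pi> then 0
      else if \<sigma> = \<pi> then 1
      else - (\<Sum>\<rho> \<in> {\<rho>. refines {1..n} \<sigma> \<rho> \<and> refines {1..n} \<rho> \<pi> \<and> \<rho> \<noteq> \<pi>}.
                moebius_partition n \<sigma> \<rho>))"
  by auto
termination
proof (relation "measure (\<lambda>(n, \<sigma>, \<pi>). card {\<rho>. refines {1..n} \<rho> \<pi>})", goal_cases)
  case (2 n \<sigma> \<pi> \<rho>)
  have "finite {\<rho>. refines {1..n} \<rho> \<pi>}"
    by (rule finite_subset[OF _ finitely_many_partition_on[of "{1..n}"]]) (auto simp: refines_def)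
  moreover have "{\<rho>'. refines {1..n} \<rho>' \<rho>} \<subset> {\<rho>. refines {1..n} \<rho> \<pi>}"
  proof (rule psubsetI)
    have le: "refines {1..n} \<rho> \<pi>" and ne: "\<rho> \<noteq> \<pi>"
      using 2 by blast+
    show "{\<rho>'. refines {1..n} \<rho>' \<rho>} \<subseteq> {\<rho>. refines {1..n} \<rho> \<pi>}"
      using le by (blast intro: refines_trans)
    have "refines {1..n} \<pi> \<pi>"
      using le by (simp add: refines_def[of _ \<rho> \<pi>] refines_refl)
    then show "{\<rho>'. refines {1..n} \<rho>' \<rho>} \<noteq> {\<rho>. refines {1..n} \<rho> \<pi>}"
      using le ne refines_asym by blast
  qed
  ultimately show ?case
    by (auto intro: psubset_card_mono)
qed simp

text \<open>Unrestricted unfolding makes the simplifier loop.\<close>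

declare moebius_partition.simps [simp del]

text \<open>The multiplicative extension \<open>u\<^sub>\<pi> = (\<Prod>V\<in>\<pi>. u\<^bsub>|V|\<^esub>)\<close> of a sequence.\<close>

definition mult_ext :: "(nat \<Rightarrow> 'a::comm_monoid_mult) \<Rightarrow> nat set set \<Rightarrow> 'a" where
  "mult_ext u \<pi> = (\<Prod>V\<in>\<pi>. u (card V))"


section \<open>Finite free probability\<close>

text \<open>The degree \<open>d\<close> is an explicit parameter throughout. For monic \<open>p\<close> of degree \<open>d\<close>,
  \<open>esym_coeff d p i\<close> is the \<open>i\<close>-th elementary symmetric polynomial of the roots; only
  \<open>i \<le> d\<close> is meaningful, since \<open>d - i\<close> truncates.\<close>

definition esym_coeff :: "nat \<Rightarrow> complex poly \<Rightarrow> nat \<Rightarrow> complex" where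
  "esym_coeff d p i = (-1) ^ i * coeff p (d - i)"

text \<open>\<^const>\<open>proots\<close> is the multiset of roots, with multiplicities.\<close>

definition moment :: "nat \<Rightarrow> complex poly \<Rightarrow> nat \<Rightarrow> complex" where
  "moment d p n = 1 / of_nat d * (\<Sum>x\<in>#proots p. x ^ n)"

definition finite_free_mult :: "nat \<Rightarrow> complex poly \<Rightarrow> complex poly \<Rightarrow> complex poly" where
  "finite_free_mult d p q =
     (\<Sum>k\<le>d. monom ((-1) ^ k * (esym_coeff d p k * esym_coeff d q k / of_nat (d choose k))) (d - k))"

text \<open>\<open>(d)\<^sub>k = d (d - 1) \<dots> (d - k + 1)\<close>. Truncation is harmless: for \<open>k > d\<close> the factor
  with \<open>i = d\<close> vanishes.\<close>

definition falling_factorial :: "nat \<Rightarrow> nat \<Rightarrow> nat" where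
  "falling_factorial d k = (\<Prod>i<k. d - i)"

definition finite_free_cumulant :: "nat \<Rightarrow> complex poly \<Rightarrow> nat \<Rightarrow> complex" where
  "finite_free_cumulant d p n =
     (- of_nat d) ^ n / (of_nat d * fact (n - 1)) *
     (\<Sum>\<pi>\<in>set_partitions n.
        (-1) ^ card \<pi> *
        (mult_ext fact \<pi> * mult_ext (esym_coeff d p) \<pi> * fact (card \<pi> - 1)) /
        of_nat (mult_ext (falling_factorial d) \<pi>))"

end

theory Submission
  imports Defs
begin

text \<open>
  Write \<open>E u\<close> for the sequence \<open>n \<mapsto> \<Sum>\<pi>\<in>P(n). u\<^sub>\<pi>\<close>. If \<open>E h = E f \<cdot> E g\<close> pointwise up to \<open>n\<close>,
  then grouping the pairs \<open>(\<sigma>, \<tau>)\<close> by their join shows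
  \<open>h\<^sub>n = (\<Sum>\<sigma> \<squnion> \<tau> = 1. f\<^sub>\<sigma> g\<^sub>\<tau>)\<close>. Put \<open>c\<^sub>k = (-1)\<^bsup>k-1\<^esup> (k-1)!\<close>, so that
  \<open>\<mu>(0, \<pi>) = c\<^sub>\<pi>\<close>. The cumulants invert \<open>E\<close>: \<open>f\<^sub>k = d\<^bsup>1-k\<^esup> c\<^sub>k \<kappa>\<^sub>k(p)\<close> satisfies
  \<open>E f = a\<^sub>k(p) / binom(d, k)\<close>, which is multiplicative under the convolution. By Newton's identities
  \<open>s\<^sub>k = d c\<^sub>k m\<^sub>k(q)\<close> satisfies \<open>E s = k! a\<^sub>k(q)\<close>, so that \<open>E\<close> of the sequence \<open>s\<close> of the convolution
  is \<open>E f \<cdot> E s\<close>. Both formulas are instances of the statement about joins, and the powers of \<open>d\<close>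
  come from \<open>\<Sum>V\<in>\<sigma>. |V| = n\<close>.
\<close>

subsection \<open>Sums over set partitions\<close>

text \<open>The weight \<open>w\<close> sees only the number of blocks: weight 1 gives the
  exponential formula, signed factorials give its inverse, a logarithm. The ground set is arbitrary
  because recursions remove blocks from it.\<close>

definition partition_sum :: "(nat \<Rightarrow> 'b) \<Rightarrow> (nat \<Rightarrow> 'b) \<Rightarrow> 'a set \<Rightarrow> 'b::comm_semiring_1" where
  "partition_sum w u A = (\<Sum>\<pi> | partition_on A \<pi>. w (card \<pi>) * (\<Prod>V\<in>\<pi>. u (card V)))"

lemma partition_sum_empty [simp]: "partition_sum w u {} = w 0"
  by (simp add: partition_sum_def partition_on_empty)

lemma partition_on_remove_block:
  assumes "partition_on A \<pi>" "V \<in> \<pi>"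
  shows "partition_on (A - V) (\<pi> - {V})" "V \<subseteq> A" "V \<noteq> {}"
proof -
  have "disjnt V (\<Union>(\<pi> - {V}))"
    using assms by (force simp: partition_on_def disjnt_def pairwise_def)
  moreover have "partition_on A (insert V (\<pi> - {V}))"
    using assms by (simp add: insert_absorb)
  ultimately have "partition_on (A - V) (\<pi> - {V}) \<and> V \<subseteq> A \<and> V \<noteq> {}"
    by (rule iffD1[OF partition_on_insert])
  then show "partition_on (A - V) (\<pi> - {V})" "V \<subseteq> A" "V \<noteq> {}"
    by auto
qed

lemma partition_on_insert_block:
  assumes "partition_on (A - V) \<rho>" "V \<subseteq> A" "V \<noteq> {}"
  shows "partition_on A (insert V \<rho>)" "V \<notin> \<rho>"
proof -
  have "disjnt V (\<Union>\<rho>)"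
    using assms(1) by (auto simp: partition_on_def disjnt_def)
  then show "partition_on A (insert V \<rho>)"
    using assms by (simp add: partition_on_insert)
  show "V \<notin> \<rho>"
    using assms by (auto simp: partition_on_def)
qed

text \<open>A partition with a marked block amounts to a nonempty subset together with a partition
  of its complement. \<open>Q\<close> limits which blocks may be marked.\<close>

lemma sum_partition_remove_block:
  assumes "finite A"
  shows "(\<Sum>\<pi> | partition_on A \<pi>. \<Sum>V | V \<in> \<pi> \<and> Q V. h V (\<pi> - {V})) =
         (\<Sum>V | V \<subseteq> A \<and> V \<noteq> {} \<and> Q V. \<Sum>\<rho> | partition_on (A - V) \<rho>. h V \<rho>)"
proof -
  have fin: "finite {\<pi>. partition_on B \<pi>}" if "B \<subseteq> A" for B
    using that assms finite_subset finitely_many_partition_on by blast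
  have "(\<Sum>\<pi> | partition_on A \<pi>. \<Sum>V | V \<in> \<pi> \<and> Q V. h V (\<pi> - {V})) =
        (\<Sum>(\<pi>, V) \<in> (SIGMA \<pi>:{\<pi>. partition_on A \<pi>}. {V. V \<in> \<pi> \<and> Q V}). h V (\<pi> - {V}))"
    using fin finite_elements[OF assms] by (intro sum.Sigma) auto
  also have "\<dots> = (\<Sum>(V, \<rho>) \<in> (SIGMA V:{V. V \<subseteq> A \<and> V \<noteq> {} \<and> Q V}. {\<rho>. partition_on (A - V) \<rho>}). h V \<rho>)"
  proof (rule sum.reindex_bij_witness[where i = "\<lambda>(V, \<rho>). (insert V \<rho>, V)" and j = "\<lambda>(\<pi>, V). (V, \<pi> - {V})"], goal_cases)
    case (2 x)
    obtain \<pi> V where x: "x = (\<pi>, V)" by (cases x)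
    with 2 have "partition_on A \<pi>" "V \<in> \<pi>" "Q V" by auto
    with x show ?case
      by (auto dest: partition_on_remove_block)
  next
    case (3 y)
    obtain V \<rho> where y: "y = (V, \<rho>)" by (cases y)
    with 3 have *: "partition_on (A - V) \<rho>" "V \<subseteq> A" "V \<noteq> {}" by auto
    with y show ?case
      using partition_on_insert_block(2)[OF *] by auto
  next
    case (4 y)
    obtain V \<rho> where y: "y = (V, \<rho>)" by (cases y)
    with 4 have *: "partition_on (A - V) \<rho>" "V \<subseteq> A" "V \<noteq> {}" "Q V" by auto
    with y show ?case
      using partition_on_insert_block(1)[OF *(1-3)] by auto
  qed (auto simp: insert_absorb)
  also have "\<dots> = (\<Sum>V | V \<subseteq> A \<and> V \<noteq> {} \<and> Q V. \<Sum>\<rho> | partition_on (A - V) \<rho>. h V \<rho>)"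
    using fin assms by (intro sum.Sigma[symmetric]) auto
  finally show ?thesis .
qed

lemma prod_card_remove_block:
  assumes "finite A" "partition_on A \<pi>" "V \<in> \<pi>"
  shows "(\<Prod>W\<in>\<pi>. u (card W)) = (u (card V) :: 'b::comm_semiring_1) * (\<Prod>W\<in>\<pi> - {V}. u (card W))"
        "card \<pi> = Suc (card (\<pi> - {V}))"
  using finite_elements[OF assms(1,2)] assms(3) by (rule prod.remove, rule card.remove)

text \<open>Exactly one block contains \<open>a\<close>, so every partition is counted once when
  that block is marked. The weight shifts because the rest has one block fewer.\<close>

lemma partition_sum_pointed:
  assumes "finite A" "a \<in> A"
  shows "partition_sum w u A =
         (\<Sum>V | V \<subseteq> A \<and> a \<in> V. u (card V) * partition_sum (\<lambda>k. w (Suc k)) u (A - V))"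
proof -
  have "partition_sum w u A = (\<Sum>\<pi> | partition_on A \<pi>. \<Sum>V | V \<in> \<pi> \<and> a \<in> V.
          u (card V) * (w (Suc (card (\<pi> - {V}))) * (\<Prod>W\<in>\<pi> - {V}. u (card W))))"
    unfolding partition_sum_def
  proof (intro sum.cong refl)
    fix \<pi> assume "\<pi> \<in> {\<pi>. partition_on A \<pi>}"
    then have \<pi>: "partition_on A \<pi>" by simp
    obtain V where V: "V \<in> \<pi>" "a \<in> V"
      using \<pi> assms(2) by (auto simp: partition_on_def)
    have "{V. V \<in> \<pi> \<and> a \<in> V} = {V}"
      using \<pi> V by (auto simp: partition_on_def disjoint_def)
    then show "w (card \<pi>) * (\<Prod>V\<in>\<pi>. u (card V)) = (\<Sum>V | V \<in> \<pi> \<and> a \<in> V.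
          u (card V) * (w (Suc (card (\<pi> - {V}))) * (\<Prod>W\<in>\<pi> - {V}. u (card W))))"
      unfolding prod_card_remove_block[OF assms(1) \<pi> V(1)] by (simp add: mult_ac)
  qed
  also have "\<dots> = (\<Sum>V | V \<subseteq> A \<and> V \<noteq> {} \<and> a \<in> V. \<Sum>\<rho> | partition_on (A - V) \<rho>.
          u (card V) * (w (Suc (card \<rho>)) * (\<Prod>W\<in>\<rho>. u (card W))))"
    by (rule sum_partition_remove_block[OF assms(1)])
  also have "\<dots> = (\<Sum>V | V \<subseteq> A \<and> a \<in> V. u (card V) * partition_sum (\<lambda>k. w (Suc k)) u (A - V))"
    by (intro sum.cong) (auto simp: partition_sum_def sum_distrib_left)
  finally show ?thesis .
qed

text \<open>Each partition arises once for every block that can be marked, whence the factor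
  \<open>of_nat k\<close>.\<close>

lemma partition_sum_any_block:
  assumes "finite A"
  shows "partition_sum (\<lambda>k. of_nat k * w k) u A =
         (\<Sum>V | V \<subseteq> A \<and> V \<noteq> {}. u (card V) * partition_sum (\<lambda>k. w (Suc k)) u (A - V))"
proof -
  have "partition_sum (\<lambda>k. of_nat k * w k) u A = (\<Sum>\<pi> | partition_on A \<pi>. \<Sum>V | V \<in> \<pi> \<and> True.
          u (card V) * (w (Suc (card (\<pi> - {V}))) * (\<Prod>W\<in>\<pi> - {V}. u (card W))))"
    unfolding partition_sum_def
  proof (intro sum.cong refl)
    fix \<pi> assume "\<pi> \<in> {\<pi>. partition_on A \<pi>}"
    then have \<pi>: "partition_on A \<pi>" by simp
    have "(\<Sum>V | V \<in> \<pi> \<and> True. u (card V) * (w (Suc (card (\<pi> - {V}))) * (\<Prod>W\<in>\<pi> - {V}. u (card W))))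
      = (\<Sum>V\<in>\<pi>. w (card \<pi>) * (\<Prod>V\<in>\<pi>. u (card V)))"
    proof (intro sum.cong)
      fix V assume "V \<in> \<pi>"
      then show "u (card V) * (w (Suc (card (\<pi> - {V}))) * (\<Prod>W\<in>\<pi> - {V}. u (card W))) =
          w (card \<pi>) * (\<Prod>V\<in>\<pi>. u (card V))"
        unfolding prod_card_remove_block[OF assms \<pi> \<open>V \<in> \<pi>\<close>] by (simp add: mult_ac)
    qed simp
    then show "of_nat (card \<pi>) * w (card \<pi>) * (\<Prod>V\<in>\<pi>. u (card V)) = (\<Sum>V | V \<in> \<pi> \<and> True.
          u (card V) * (w (Suc (card (\<pi> - {V}))) * (\<Prod>W\<in>\<pi> - {V}. u (card W))))"
      by (simp add: mult.assoc)
  qed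
  also have "\<dots> = (\<Sum>V | V \<subseteq> A \<and> V \<noteq> {} \<and> True. \<Sum>\<rho> | partition_on (A - V) \<rho>.
          u (card V) * (w (Suc (card \<rho>)) * (\<Prod>W\<in>\<rho>. u (card W))))"
    by (rule sum_partition_remove_block[OF assms])
  also have "\<dots> = (\<Sum>V | V \<subseteq> A \<and> V \<noteq> {}. u (card V) * partition_sum (\<lambda>k. w (Suc k)) u (A - V))"
    by (intro sum.cong) (auto simp: partition_sum_def sum_distrib_left)
  finally show ?thesis .
qed

section \<open>Reduction of partition sums to cardinalities\<close>

lemma sum_subsets_by_card:
  fixes h :: "nat \<Rightarrow> 'b::comm_semiring_1"
  assumes "finite A"
  shows "(\<Sum>V | V \<subseteq> A. h (card V)) = (\<Sum>k\<le>card A. of_nat (card A choose k) * h k)"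
proof -
  have "(\<Sum>V | V \<subseteq> A. h (card V)) = (\<Sum>k\<le>card A. \<Sum>V\<in>{V \<in> {V. V \<subseteq> A}. card V = k}. h (card V))"
    using assms by (intro sum.group[symmetric]) (auto intro: card_mono)
  also have "\<dots> = (\<Sum>k\<le>card A. of_nat (card A choose k) * h k)"
    using assms by (intro sum.cong refl) (simp add: n_subsets)
  finally show ?thesis .
qed

lemma sum_pointed_subsets_by_card:
  fixes h :: "nat \<Rightarrow> 'b::comm_semiring_1"
  assumes "finite A" "a \<in> A" "card A = Suc n"
  shows "(\<Sum>V | V \<subseteq> A \<and> a \<in> V. h (card V)) = (\<Sum>k\<le>n. of_nat (n choose k) * h (Suc k))"
proof -
  have card: "card (A - {a}) = n"
    using assms by simp
  have "(\<Sum>V | V \<subseteq> A \<and> a \<in> V. h (card V)) = (\<Sum>V | V \<subseteq> A - {a}. h (Suc (card V)))"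
  proof (rule sum.reindex_bij_witness[where i = "insert a" and j = "\<lambda>V. V - {a}"], goal_cases)
    case (5 V)
    then have "finite V" "a \<in> V" using assms finite_subset by auto
    then show ?case by (metis card.remove)
  qed (use assms in auto)
  also have "\<dots> = (\<Sum>k\<le>n. of_nat (n choose k) * h (Suc k))"
    using sum_subsets_by_card[of "A - {a}" "\<lambda>k. h (Suc k)"] assms card by simp
  finally show ?thesis .
qed

text \<open>The value of \<^const>\<open>partition_sum\<close> depends only on the cardinality of the set. The recursion
  splits off the block of a distinguished point and never reads \<open>u 0\<close>.\<close>

fun partition_transform :: "(nat \<Rightarrow> 'b) \<Rightarrow> (nat \<Rightarrow> 'b) \<Rightarrow> nat \<Rightarrow> 'b::comm_semiring_1" where
  "partition_transform w u 0 = w 0"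
| "partition_transform w u (Suc n) =
     (\<Sum>k\<le>n. of_nat (n choose k) * (u (Suc k) * partition_transform (\<lambda>k. w (Suc k)) u (n - k)))"

lemma partition_sum_eq_transform:
  assumes "finite A"
  shows "partition_sum w u A = partition_transform w u (card A)"
  using assms
\<comment> \<open>\<open>w\<close> is generalised because splitting off a block shifts it.\<close>
proof (induction "card A" arbitrary: A w rule: less_induct)
  case less
  show ?case
  proof (cases "card A")
    case 0
    then show ?thesis using less.prems by simp
  next
    case (Suc n)
    then obtain a where a: "a \<in> A" by fastforce
    have "partition_sum w u A = (\<Sum>V | V \<subseteq> A \<and> a \<in> V.
        u (card V) * partition_transform (\<lambda>k. w (Suc k)) u (Suc n - card V))"
      unfolding partition_sum_pointed[OF less.prems a]
    proof (intro sum.cong refl arg_cong[where f = "(*) _"])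
      fix V assume V: "V \<in> {V. V \<subseteq> A \<and> a \<in> V}"
      then have "finite V" "card V > 0"
        using less.prems finite_subset by (auto simp: card_gt_0_iff)
      then have "card (A - V) = Suc n - card V" "card (A - V) < card A"
        using V Suc by (auto simp: card_Diff_subset)
      then show "partition_sum (\<lambda>k. w (Suc k)) u (A - V) =
          partition_transform (\<lambda>k. w (Suc k)) u (Suc n - card V)"
        using less by simp
    qed
    then show ?thesis
      using sum_pointed_subsets_by_card[OF less.prems a Suc,
          of "\<lambda>j. u j * partition_transform (\<lambda>k. w (Suc k)) u (Suc n - j)"] Suc by simp
  qed
qed

text \<open>Weighting a partition by its number of blocks amounts to marking one of its blocks.\<close>

lemma partition_transform_any_block:
  assumes "u 0 = 0"
  shows "partition_transform (\<lambda>k. of_nat k * w k) u n =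
   (\<Sum>k\<le>n. of_nat (n choose k) * (u k * partition_transform (\<lambda>k. w (Suc k)) u (n - k)))"
proof -
  have "partition_transform (\<lambda>k. of_nat k * w k) u n = (\<Sum>V | V \<subseteq> {1..n} \<and> V \<noteq> {}.
      u (card V) * partition_sum (\<lambda>k. w (Suc k)) u ({1..n} - V))"
    using partition_sum_any_block[of "{1..n}" w u] by (simp add: partition_sum_eq_transform)
  also have "\<dots> = (\<Sum>V | V \<subseteq> {1..n} \<and> V \<noteq> {}.
      u (card V) * partition_transform (\<lambda>k. w (Suc k)) u (n - card V))"
    by (intro sum.cong refl) (auto simp: partition_sum_eq_transform card_Diff_subset finite_subset)
  \<comment> \<open>\<open>u 0 = 0\<close> admits the empty set, so that the sum can be sorted by
    cardinality.\<close>
  also have "\<dots> = (\<Sum>V | V \<subseteq> {1..n}. u (card V) * partition_transform (\<lambda>k. w (Suc k)) u (n - card V))"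
    by (intro sum.mono_neutral_left) (auto simp: assms)
  finally show ?thesis
    using sum_subsets_by_card[of "{1..n}" "\<lambda>j. u j * partition_transform (\<lambda>k. w (Suc k)) u (n - j)"] by simp
qed

text \<open>A constant weight is invariant under the shift, so the recursion closes on itself. For
  exponential generating functions it reads F' = U' F, the equation of exp U.\<close>

lemma partition_transform_unique:
  assumes "F 0 = 1"
    and "\<And>n. F (Suc n) = (\<Sum>k\<le>n. of_nat (n choose k) * (u (Suc k) * F (n - k)))"
  shows "partition_transform (\<lambda>_. 1) u n = F n"
proof (induction n rule: less_induct)
  case (less n)
  show ?case
  proof (cases n)
    case 0
    then show ?thesis by (simp add: assms(1))
  next
    case (Suc m)
    have "partition_transform (\<lambda>_. 1) u (m - k) = F (m - k)" for k
      using less[of "m - k"] Suc by simp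
    then show ?thesis
      unfolding Suc assms(2) by simp
  qed
qed

subsection \<open>Pairs of partitions and their join\<close>

text \<open>For a partition \<open>\<sigma>\<close> of a set containing \<open>V\<close>, this means
  that \<open>V\<close> is a union of blocks.\<close>

definition saturated :: "'a set \<Rightarrow> 'a set set \<Rightarrow> bool" where
  "saturated V \<sigma> \<longleftrightarrow> (\<forall>B\<in>\<sigma>. B \<subseteq> V \<or> B \<inter> V = {})"

text \<open>The join being the one-block partition, phrased without the join so that it can be used
  on every subset of the ground set.\<close>

definition connected_pair :: "'a set \<Rightarrow> 'a set set \<Rightarrow> 'a set set \<Rightarrow> bool" where
  "connected_pair A \<sigma> \<tau> \<longleftrightarrow> (\<forall>V\<subseteq>A. V \<noteq> {} \<and> saturated V \<sigma> \<and> saturated V \<tau> \<longrightarrow> V = A)"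

text \<open>The block of \<open>a\<close> in the join, obtained as the least common union of blocks
  around \<open>a\<close>.\<close>

definition pair_component :: "'a set \<Rightarrow> 'a set set \<Rightarrow> 'a set set \<Rightarrow> 'a \<Rightarrow> 'a set" where
  "pair_component A \<sigma> \<tau> a = \<Inter>{V. V \<subseteq> A \<and> a \<in> V \<and> saturated V \<sigma> \<and> saturated V \<tau>}"

lemma refines_saturated:
  assumes "refines A \<pi> \<rho>" "V \<in> \<rho>"
  shows "saturated V \<pi>"
  unfolding saturated_def
proof
  fix B assume "B \<in> \<pi>"
  then obtain W where W: "W \<in> \<rho>" "B \<subseteq> W"
    using assms unfolding refines_def by blast
  have "partition_on A \<rho>"
    using assms by (simp add: refines_def)
  then show "B \<subseteq> V \<or> B \<inter> V = {}"
    using W assms(2) disjointD[OF partition_onD2, of A \<rho> W V] by blast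
qed

lemma partition_on_blocks_inside:
  assumes "partition_on A \<sigma>" "V \<subseteq> A" "saturated V \<sigma>"
  shows "partition_on V {B\<in>\<sigma>. B \<subseteq> V}"
proof (rule partition_onI)
  show "\<Union>{B\<in>\<sigma>. B \<subseteq> V} = V"
  proof
    show "V \<subseteq> \<Union>{B\<in>\<sigma>. B \<subseteq> V}"
    proof
      fix x assume x: "x \<in> V"
      then obtain B where "B \<in> \<sigma>" "x \<in> B"
        using assms(2) partition_onD1[OF assms(1)] by blast
      with x show "x \<in> \<Union>{B\<in>\<sigma>. B \<subseteq> V}"
        using assms(3) unfolding saturated_def by blast
    qed
  qed blast
qed (use partition_onD2[OF assms(1)] partition_onD3[OF assms(1)] in \<open>auto simp: pairwise_def\<close>)

lemma partition_on_blocks_outside: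
  assumes "partition_on A \<sigma>" "V \<subseteq> A" "saturated V \<sigma>"
  shows "partition_on (A - V) {B\<in>\<sigma>. \<not> B \<subseteq> V}"
proof (rule partition_onI)
  show "\<Union>{B\<in>\<sigma>. \<not> B \<subseteq> V} = A - V"
    using partition_onD1[OF assms(1)] assms(3) unfolding saturated_def by blast
qed (use partition_onD2[OF assms(1)] partition_onD3[OF assms(1)] in \<open>auto simp: pairwise_def\<close>)

lemma partition_on_disjoint_Un:
  assumes "partition_on V \<sigma>" "partition_on W \<tau>" "V \<inter> W = {}"
  shows "partition_on (V \<union> W) (\<sigma> \<union> \<tau>)" "{B\<in>\<sigma> \<union> \<tau>. B \<subseteq> V} = \<sigma>" "{B\<in>\<sigma> \<union> \<tau>. \<not> B \<subseteq> V} = \<tau>"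
    "\<sigma> \<inter> \<tau> = {}" "saturated V (\<sigma> \<union> \<tau>)"
proof -
  have out: "\<not> B \<subseteq> V \<and> B \<inter> V = {}" if "B \<in> \<tau>" for B
  proof -
    have "B \<subseteq> W" "B \<noteq> {}" using that assms(2) unfolding partition_on_def by auto
    then show ?thesis using assms(3) by blast
  qed
  have ins: "B \<subseteq> V" if "B \<in> \<sigma>" for B
    using that assms(1) unfolding partition_on_def by auto
  show "partition_on (V \<union> W) (\<sigma> \<union> \<tau>)"
    using assms unfolding partition_on_def
    by (intro conjI disjoint_union) auto
  show "{B\<in>\<sigma> \<union> \<tau>. B \<subseteq> V} = \<sigma>" "{B\<in>\<sigma> \<union> \<tau>. \<not> B \<subseteq> V} = \<tau>" "\<sigma> \<inter> \<tau> = {}" "saturated V (\<sigma> \<union> \<tau>)"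
    using out ins unfolding saturated_def by blast+
qed

text \<open>Saturation survives intersections. For connectedness, if \<open>U\<close> inside
  \<open>C\<close> is saturated, so is \<open>C - U\<close>; whichever contains \<open>a\<close>
  must contain \<open>C\<close> by minimality, which forces \<open>U = C\<close> when
  \<open>U\<close> is nonempty.\<close>

lemma pair_component_props:
  assumes "partition_on A \<sigma>" "partition_on A \<tau>" "a \<in> A"
  defines "C \<equiv> pair_component A \<sigma> \<tau> a"
  shows "C \<subseteq> A" "a \<in> C" "saturated C \<sigma>" "saturated C \<tau>"
    "connected_pair C {B\<in>\<sigma>. B \<subseteq> C} {B\<in>\<tau>. B \<subseteq> C}"
proof -
  let ?S = "{V. V \<subseteq> A \<and> a \<in> V \<and> saturated V \<sigma> \<and> saturated V \<tau>}"
  have A: "A \<in> ?S"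
    using assms(1-3) by (auto simp: saturated_def partition_on_def)
  then show CA: "C \<subseteq> A"
    unfolding C_def pair_component_def by blast
  show aC: "a \<in> C"
    unfolding C_def pair_component_def by blast
  \<comment> \<open>A block lies in every member of the family, hence in \<open>C\<close>, or it
    misses some member, hence misses \<open>C\<close>.\<close>
  have sat: "saturated C \<rho>" if "\<And>V. V \<in> ?S \<Longrightarrow> saturated V \<rho>" for \<rho>
    unfolding saturated_def
  proof
    fix B assume B: "B \<in> \<rho>"
    show "B \<subseteq> C \<or> B \<inter> C = {}"
    proof (cases "\<forall>V\<in>?S. B \<subseteq> V")
      case True
      then show ?thesis unfolding C_def pair_component_def by blast
    next
      case False
      then obtain V where V: "V \<in> ?S" "\<not> B \<subseteq> V" by blast
      then have "B \<inter> V = {}" using that[OF V(1)] B unfolding saturated_def by blast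
      then show ?thesis using V(1) unfolding C_def pair_component_def by blast
    qed
  qed
  show s\<sigma>: "saturated C \<sigma>" and s\<tau>: "saturated C \<tau>"
    by (rule sat, simp)+
  \<comment> \<open>Since \<open>C\<close> is a union of blocks, saturation relative to the blocks
    inside \<open>C\<close> extends to all blocks, also for the complement within
    \<open>C\<close>.\<close>
  have ext: "saturated U \<rho> \<and> saturated (C - U) \<rho>"
    if "U \<subseteq> C" "saturated C \<rho>" "saturated U {B\<in>\<rho>. B \<subseteq> C}" for U \<rho>
    unfolding saturated_def
  proof (intro conjI ballI)
    fix B assume "B \<in> \<rho>"
    then have "B \<subseteq> C \<and> (B \<subseteq> U \<or> B \<inter> U = {}) \<or> B \<inter> C = {}"
      using that unfolding saturated_def by blast
    then show "B \<subseteq> U \<or> B \<inter> U = {}" "B \<subseteq> C - U \<or> B \<inter> (C - U) = {}"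
      using that(1) by blast+
  qed
  show "connected_pair C {B\<in>\<sigma>. B \<subseteq> C} {B\<in>\<tau>. B \<subseteq> C}"
    unfolding connected_pair_def
  proof (intro allI impI, elim conjE)
    fix U assume U: "U \<subseteq> C" "U \<noteq> {}" "saturated U {B\<in>\<sigma>. B \<subseteq> C}" "saturated U {B\<in>\<tau>. B \<subseteq> C}"
    have min: "C \<subseteq> V" if "V \<in> ?S" for V
      using that unfolding C_def pair_component_def by blast
    show "U = C"
    proof (cases "a \<in> U")
      case True
      then have "U \<in> ?S"
        using U CA ext[OF U(1) s\<sigma> U(3)] ext[OF U(1) s\<tau> U(4)] by blast
      then show ?thesis using min U(1) by blast
    next
      case False
      then have "C - U \<in> ?S"
        using U CA aC ext[OF U(1) s\<sigma> U(3)] ext[OF U(1) s\<tau> U(4)] by blast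
      then show ?thesis using min U(1,2) by blast
    qed
  qed
qed

text \<open>\<open>V\<close> belongs to the intersected family, so the component lies in
  \<open>V\<close>; being a nonempty saturated subset of a connected \<open>V\<close>, it is all of
  \<open>V\<close>.\<close>

lemma pair_component_unique:
  assumes "V \<subseteq> A" "a \<in> V" "saturated V \<sigma>" "saturated V \<tau>"
    "connected_pair V {B\<in>\<sigma>. B \<subseteq> V} {B\<in>\<tau>. B \<subseteq> V}"
    and "partition_on A \<sigma>" "partition_on A \<tau>"
  shows "pair_component A \<sigma> \<tau> a = V"
proof -
  define C where "C = pair_component A \<sigma> \<tau> a"
  note props = pair_component_props[OF assms(6,7), of a, folded C_def]
  have a: "a \<in> A" using assms(1,2) by blast
  have "C \<subseteq> V"
    using assms(1-4) unfolding C_def pair_component_def by blast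
  moreover have "saturated C {B\<in>\<sigma>. B \<subseteq> V}" "saturated C {B\<in>\<tau>. B \<subseteq> V}"
    using props(3,4)[OF a] by (auto simp: saturated_def)
  ultimately show ?thesis
    using assms(5) props(2)[OF a] unfolding connected_pair_def C_def by blast
qed

section \<open>Weighted sums over connected pairs\<close>

definition pair_weight :: "(nat \<Rightarrow> 'b) \<Rightarrow> (nat \<Rightarrow> 'b) \<Rightarrow> 'a set set \<times> 'a set set \<Rightarrow> 'b::comm_semiring_1" where
  "pair_weight f g st = (\<Prod>V\<in>fst st. f (card V)) * (\<Prod>V\<in>snd st. g (card V))"

definition connected_sum :: "(nat \<Rightarrow> 'b) \<Rightarrow> (nat \<Rightarrow> 'b) \<Rightarrow> 'a set \<Rightarrow> 'b::comm_semiring_1" where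
  "connected_sum f g A = (\<Sum>st | partition_on A (fst st) \<and> partition_on A (snd st) \<and>
     connected_pair A (fst st) (snd st). pair_weight f g st)"

lemma partition_pairs_eq: "{st. partition_on A (fst st) \<and> partition_on A (snd st)} =
    {\<sigma>. partition_on A \<sigma>} \<times> {\<tau>. partition_on A \<tau>}"
  by auto

lemma sum_pair_weight:
  "(\<Sum>st | partition_on A (fst st) \<and> partition_on A (snd st). pair_weight f g st) =
   partition_sum (\<lambda>_. 1) f A * partition_sum (\<lambda>_. 1) g A"
  unfolding partition_pairs_eq partition_sum_def sum_product pair_weight_def
  by (simp add: sum.cartesian_product case_prod_unfold)

lemma pair_weight_Un:
  assumes "finite V" "finite W" "V \<inter> W = {}" "partition_on V (fst s)" "partition_on V (snd s)"
    "partition_on W (fst t)" "partition_on W (snd t)"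
  shows "pair_weight f g (fst s \<union> fst t, snd s \<union> snd t) = pair_weight f g s * pair_weight f g t"
  unfolding pair_weight_def fst_conv snd_conv
  by (subst (1 2) prod.union_disjoint)
     (use assms in \<open>simp_all add: finite_elements partition_on_disjoint_Un mult_ac\<close>)

text \<open>A pair of partitions is split along the block of \<open>a\<close> in the join: on that block the pair is
  connected, and on the rest it is arbitrary.\<close>

lemma partition_sum_mult_pointed:
  assumes "finite A" "a \<in> A"
  shows "partition_sum (\<lambda>_. 1) f A * partition_sum (\<lambda>_. 1) g A =
    (\<Sum>V | V \<subseteq> A \<and> a \<in> V. connected_sum f g V *
       (partition_sum (\<lambda>_. 1) f (A - V) * partition_sum (\<lambda>_. 1) g (A - V)))"
proof -
  let ?P = "\<lambda>B. {st. partition_on B (fst st) \<and> partition_on B (snd st)}"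
  let ?K = "\<lambda>B. {st. partition_on B (fst st) \<and> partition_on B (snd st) \<and> connected_pair B (fst st) (snd st)}"
  let ?comp = "\<lambda>st. pair_component A (fst st) (snd st) a"
  have fin: "finite (?P B)" if "finite B" for B :: "'a set"
    unfolding partition_pairs_eq using finitely_many_partition_on[OF that] by blast
  have "partition_sum (\<lambda>_. 1) f A * partition_sum (\<lambda>_. 1) g A = (\<Sum>st\<in>?P A. pair_weight f g st)"
    by (rule sum_pair_weight[symmetric])
  also have "\<dots> = (\<Sum>V | V \<subseteq> A \<and> a \<in> V. \<Sum>st\<in>{st\<in>?P A. ?comp st = V}. pair_weight f g st)"
  proof (rule sum.group[symmetric])
    show "?comp ` ?P A \<subseteq> {V. V \<subseteq> A \<and> a \<in> V}"
      using pair_component_props(1,2)[OF _ _ assms(2)] by blast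
  qed (use assms fin in auto)
  also have "\<dots> = (\<Sum>V | V \<subseteq> A \<and> a \<in> V. connected_sum f g V *
       (partition_sum (\<lambda>_. 1) f (A - V) * partition_sum (\<lambda>_. 1) g (A - V)))"
  proof (intro sum.cong refl)
    fix V assume "V \<in> {V. V \<subseteq> A \<and> a \<in> V}"
    then have V: "V \<subseteq> A" "a \<in> V" "V \<inter> (A - V) = {}" "V \<union> (A - V) = A" by auto
    have finV: "finite V" "finite (A - V)" using V assms finite_subset by auto
    have "(\<Sum>st\<in>{st\<in>?P A. ?comp st = V}. pair_weight f g st) =
      (\<Sum>(s, t)\<in>?K V \<times> ?P (A - V). pair_weight f g s * pair_weight f g t)"
    proof (rule sum.reindex_bij_witness[where
          i = "\<lambda>(s, t). (fst s \<union> fst t, snd s \<union> snd t)" and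
          j = "\<lambda>st. (({B\<in>fst st. B \<subseteq> V}, {B\<in>snd st. B \<subseteq> V}), ({B\<in>fst st. \<not> B \<subseteq> V}, {B\<in>snd st. \<not> B \<subseteq> V}))"], goal_cases)
      case (1 st)
      show ?case by (auto simp: prod_eq_iff)
    next
      case (2 st)
      then have st: "partition_on A (fst st)" "partition_on A (snd st)" "?comp st = V" by auto
      note c = pair_component_props[OF st(1,2), of a, unfolded st(3)]
      have a: "a \<in> A" using assms by simp
      show ?case
        using partition_on_blocks_inside[OF st(1) V(1) c(3)[OF a]]
          partition_on_blocks_inside[OF st(2) V(1) c(4)[OF a]]
          partition_on_blocks_outside[OF st(1) V(1) c(3)[OF a]]
          partition_on_blocks_outside[OF st(2) V(1) c(4)[OF a]] c(5)[OF a]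
        by simp
    next
      case (3 x)
      obtain s t where x: "x = (s, t)" by (cases x)
      with 3 have p: "partition_on V (fst s)" "partition_on V (snd s)"
        "partition_on (A - V) (fst t)" "partition_on (A - V) (snd t)" by auto
      show ?case
        unfolding x by (simp add: prod_eq_iff partition_on_disjoint_Un(2,3)[OF p(1,3) V(3), simplified]
            partition_on_disjoint_Un(2,3)[OF p(2,4) V(3), simplified])
    next
      case (4 x)
      obtain s t where x: "x = (s, t)" by (cases x)
      with 4 have p: "partition_on V (fst s)" "partition_on V (snd s)"
        "partition_on (A - V) (fst t)" "partition_on (A - V) (snd t)"
        "connected_pair V (fst s) (snd s)" by auto
      note d = partition_on_disjoint_Un[OF p(1,3) V(3), unfolded V(4)]
        and e = partition_on_disjoint_Un[OF p(2,4) V(3), unfolded V(4)]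
      \<comment> \<open>Gluing must neither enlarge nor shrink the component: connectedness on
        \<open>V\<close> and saturation of \<open>V\<close> determine it.\<close>
      have "pair_component A (fst s \<union> fst t) (snd s \<union> snd t) a = V"
        by (rule pair_component_unique[OF V(1,2) d(5) e(5) _ d(1) e(1)])
          (use p(5) in \<open>simp only: d(2) e(2)\<close>)
      then show ?case
        unfolding x using d(1) e(1) by simp
    next
      case (5 st)
      then have st: "partition_on A (fst st)" "partition_on A (snd st)" "?comp st = V" by auto
      note c = pair_component_props[OF st(1,2), of a, unfolded st(3)]
      have a: "a \<in> A" using assms by simp
      have st_eq: "st = ({B\<in>fst st. B \<subseteq> V} \<union> {B\<in>fst st. \<not> B \<subseteq> V}, {B\<in>snd st. B \<subseteq> V} \<union> {B\<in>snd st. \<not> B \<subseteq> V})"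
        by (auto simp: prod_eq_iff)
      have "pair_weight f g st = pair_weight f g ({B\<in>fst st. B \<subseteq> V}, {B\<in>snd st. B \<subseteq> V}) *
          pair_weight f g ({B\<in>fst st. \<not> B \<subseteq> V}, {B\<in>snd st. \<not> B \<subseteq> V})"
        by (subst st_eq, rule pair_weight_Un[OF finV V(3), where s = "(_, _)" and t = "(_, _)", unfolded fst_conv snd_conv])
          (simp_all add: partition_on_blocks_inside[OF st(1) V(1) c(3)[OF a]]
          partition_on_blocks_inside[OF st(2) V(1) c(4)[OF a]]
          partition_on_blocks_outside[OF st(1) V(1) c(3)[OF a]]
          partition_on_blocks_outside[OF st(2) V(1) c(4)[OF a]])
      then show ?case by simp
    qed
    also have "\<dots> = connected_sum f g V *
       (partition_sum (\<lambda>_. 1) f (A - V) * partition_sum (\<lambda>_. 1) g (A - V))"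
      unfolding connected_sum_def sum_pair_weight[symmetric] sum_product
      by (simp add: sum.cartesian_product)
    finally show "(\<Sum>st\<in>{st\<in>?P A. ?comp st = V}. pair_weight f g st) = connected_sum f g V *
       (partition_sum (\<lambda>_. 1) f (A - V) * partition_sum (\<lambda>_. 1) g (A - V))" .
  qed
  finally show ?thesis .
qed

text \<open>Both sides of the product hypothesis expand over the set \<open>V\<close> containing a fixed point; all
  terms with \<open>V \<noteq> A\<close> agree by induction, hence so do the terms with \<open>V = A\<close>.\<close>

lemma connected_sum_eq:
  fixes f g h :: "nat \<Rightarrow> 'b::comm_ring_1"
  assumes "\<And>m. m \<le> n \<Longrightarrow> partition_transform (\<lambda>_. 1) h m =
      partition_transform (\<lambda>_. 1) f m * partition_transform (\<lambda>_. 1) g m"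
    and "finite A" "A \<noteq> {}" "card A \<le> n"
  shows "connected_sum f g A = h (card A)"
  using assms(2-)
proof (induction "card A" arbitrary: A rule: less_induct)
  case less
  obtain a where a: "a \<in> A" using less.prems by blast
  let ?E = "\<lambda>B. partition_sum (\<lambda>_. 1) f B * partition_sum (\<lambda>_. 1) g B"
  have E: "?E B = partition_sum (\<lambda>_. 1) h B" if "B \<subseteq> A" for B
    using that less.prems finite_subset[OF that] card_mono[OF _ that]
    by (simp add: partition_sum_eq_transform assms(1))
  let ?S = "{V. V \<subseteq> A \<and> a \<in> V}"
  have S: "finite ?S" "A \<in> ?S" using less.prems a by auto
  \<comment> \<open>The left side expands the product by the component of \<open>a\<close>, the
    right side expands the sum for \<open>h\<close> by the block of \<open>a\<close>.\<close>
  have "(\<Sum>V\<in>?S. connected_sum f g V * ?E (A - V)) = (\<Sum>V\<in>?S. h (card V) * ?E (A - V))"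
    using E[of A] partition_sum_mult_pointed[OF less.prems(1) a, of f g]
      partition_sum_pointed[OF less.prems(1) a, of "\<lambda>_. 1" h] E by simp
  moreover have "(\<Sum>V\<in>?S - {A}. connected_sum f g V * ?E (A - V)) = (\<Sum>V\<in>?S - {A}. h (card V) * ?E (A - V))"
  proof (intro sum.cong refl)
    fix V assume V: "V \<in> ?S - {A}"
    then have "V \<subset> A" by blast
    then have "card V < card A" using less.prems psubset_card_mono by blast
    then show "connected_sum f g V * ?E (A - V) = h (card V) * ?E (A - V)"
      using less.hyps[of V] V less.prems finite_subset by fastforce
  qed
  \<comment> \<open>The remaining term \<open>V = A\<close> carries the factor
    \<open>?E {} = 1\<close>.\<close>
  ultimately show ?case
    by (simp add: sum.remove[OF S])
qed

text \<open>Blocks of an upper bound are saturated for both partitions, so connectedness leaves only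
  the top as upper bound. Conversely, a proper nonempty saturated \<open>V\<close> yields the upper
  bound consisting of \<open>V\<close> and its complement, which is not above the top.\<close>

lemma connected_pair_iff_join_top:
  assumes "\<sigma> \<in> set_partitions n" "\<tau> \<in> set_partitions n" "n \<ge> 1"
  shows "partition_join n \<sigma> \<tau> = top_partition n \<longleftrightarrow> connected_pair {1..n} \<sigma> \<tau>"
proof
  let ?A = "{1..n}"
  have p: "partition_on ?A \<sigma>" "partition_on ?A \<tau>"
    using assms by (auto simp: set_partitions_def)
  have top: "partition_on ?A (top_partition n)"
    unfolding top_partition_def using assms(3) by (intro partition_on_space) auto
  have le_top: "refines ?A \<rho> (top_partition n)" if "partition_on ?A \<rho>" for \<rho>
    unfolding refines_def using that top partition_onD1[OF that] by (auto simp: top_partition_def)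
  show "partition_join n \<sigma> \<tau> = top_partition n" if conn: "connected_pair ?A \<sigma> \<tau>"
  proof -
    have "is_partition_join n \<sigma> \<tau> (top_partition n)"
      unfolding is_partition_join_def
    proof (intro conjI allI impI)
      fix \<rho> assume \<rho>: "refines ?A \<sigma> \<rho> \<and> refines ?A \<tau> \<rho>"
      then have pr: "partition_on ?A \<rho>" by (simp add: refines_def)
      obtain V where V: "V \<in> \<rho>" "1 \<in> V"
        using partition_onD1[OF pr] assms(3) by (metis UnionE atLeastAtMost_iff order_refl)
      have "saturated V \<sigma>" "saturated V \<tau>"
        using \<rho> V(1) refines_saturated by blast+
      then have VA: "V = ?A"
        using conn V partition_onD1[OF pr] unfolding connected_pair_def by blast
      then have "\<rho> = {?A}"
        using V pr partition_on_remove_block(1)[OF pr V(1)] by (auto simp: partition_on_empty)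
      then show "refines ?A (top_partition n) \<rho>"
        using top by (simp add: top_partition_def refines_refl)
    qed (use le_top p in auto)
    then show ?thesis
      using is_partition_join_partition_join[OF assms(1,2)] is_partition_join_unique by blast
  qed
  show "connected_pair ?A \<sigma> \<tau>" if eq: "partition_join n \<sigma> \<tau> = top_partition n"
    unfolding connected_pair_def
  proof (intro allI impI, elim conjE, rule ccontr)
    fix V assume V: "V \<subseteq> ?A" "V \<noteq> {}" "saturated V \<sigma>" "saturated V \<tau>" "V \<noteq> ?A"
    let ?\<rho> = "{V, ?A - V}"
    have \<rho>: "partition_on ?A ?\<rho>"
      using V by (auto simp: partition_on_def disjoint_def)
    have "refines ?A \<pi> ?\<rho>" if "partition_on ?A \<pi>" "saturated V \<pi>" for \<pi>
      unfolding refines_def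
    proof (intro conjI ballI)
      fix X assume "X \<in> \<pi>"
      then have XA: "X \<subseteq> ?A" and XV: "X \<subseteq> V \<or> X \<inter> V = {}"
        using that partition_onD1[OF that(1)] unfolding saturated_def by auto
      from XV show "\<exists>Y\<in>?\<rho>. X \<subseteq> Y"
      proof
        assume "X \<subseteq> V"
        then show ?thesis by simp
      next
        assume "X \<inter> V = {}"
        then have "X \<subseteq> ?A - V" using XA by blast
        then show ?thesis by simp
      qed
    qed (use that \<rho> in auto)
    then have "refines ?A \<sigma> ?\<rho>" "refines ?A \<tau> ?\<rho>"
      using p V(3,4) by blast+
    then have "refines ?A (top_partition n) ?\<rho>"
      using is_partition_join_partition_join[OF assms(1,2)] unfolding is_partition_join_def eq by blast
    then show False
      using V unfolding refines_def top_partition_def by blast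
  qed
qed

subsection \<open>The Moebius function\<close>

text \<open>For \<open>k \<ge> 1\<close> this is the Moebius function from the bottom to the top of
  the lattice of partitions of \<open>k\<close> points.\<close>

definition moebius_block :: "nat \<Rightarrow> int" where
  "moebius_block k = (-1) ^ (k - 1) * fact (k - 1)"

text \<open>The generating function of \<open>moebius_block\<close> over positive indices is log (1
  + x), whose exponential is 1 + x.\<close>

lemma partition_transform_moebius_block:
  "partition_transform (\<lambda>_. 1) moebius_block n = (if n \<le> 1 then 1 else 0)"
proof (rule partition_transform_unique)
  fix n :: nat
  show "(if Suc n \<le> 1 then 1 else 0) =
    (\<Sum>k\<le>n. of_nat (n choose k) * (moebius_block (Suc k) * (if n - k \<le> 1 then 1 else 0)))"
  proof (cases n)
    case 0
    then show ?thesis by (simp add: moebius_block_def)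
  next
    case (Suc m)
    \<comment> \<open>Only \<open>n - k \<le> 1\<close> contributes, and the two surviving terms
      cancel.\<close>
    have "(\<Sum>k\<le>n. of_nat (n choose k) * (moebius_block (Suc k) * (if n - k \<le> 1 then 1 else 0))) =
        (\<Sum>k\<in>{m, Suc m}. of_nat (n choose k) * moebius_block (Suc k))"
      unfolding Suc by (intro sum.mono_neutral_cong_right) auto
    also have "\<dots> = 0"
      by (simp add: Suc moebius_block_def algebra_simps)
    finally show ?thesis by (simp add: Suc)
  qed
qed simp

text \<open>Refining \<open>\<pi>\<close> means partitioning each of its blocks independently, so
  the sum factorises; the induction peels off one block at a time.\<close>

lemma sum_refinements:
  assumes "finite A" "partition_on A \<pi>"
  shows "(\<Sum>\<rho> | refines A \<rho> \<pi>. \<Prod>B\<in>\<rho>. u (card B)) = (\<Prod>V\<in>\<pi>. partition_sum (\<lambda>_. 1) u V)"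
proof -
  have "finite \<pi>" using assms finite_elements by blast
  then show ?thesis
    using assms
  proof (induction \<pi> arbitrary: A rule: finite_induct)
    case empty
    then have "A = {}" by (auto simp: partition_on_def)
    then have "{\<rho>. refines A \<rho> {}} = {{}}"
      by (auto simp: refines_def partition_on_empty)
    then show ?case by simp
  next
    case (insert V \<pi>)
    have \<pi>: "partition_on (A - V) \<pi>" "V \<subseteq> A" "V \<noteq> {}"
      using partition_on_remove_block[OF insert.prems(2), of V] insert.hyps by simp_all
    have V: "V \<inter> (A - V) = {}" "V \<union> (A - V) = A" using \<pi> by auto
    have fin: "finite V" "finite (A - V)" using insert.prems \<pi> finite_subset by auto
    have "(\<Sum>\<rho> | refines A \<rho> (insert V \<pi>). \<Prod>B\<in>\<rho>. u (card B)) =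
      (\<Sum>(\<rho>1, \<rho>2)\<in>{\<rho>. partition_on V \<rho>} \<times> {\<rho>. refines (A - V) \<rho> \<pi>}.
        (\<Prod>B\<in>\<rho>1. u (card B)) * (\<Prod>B\<in>\<rho>2. u (card B)))"
    proof (rule sum.reindex_bij_witness[where i = "\<lambda>(\<rho>1, \<rho>2). \<rho>1 \<union> \<rho>2" and
          j = "\<lambda>\<rho>. ({B\<in>\<rho>. B \<subseteq> V}, {B\<in>\<rho>. \<not> B \<subseteq> V})"], goal_cases)
      case (1 \<rho>)
      show ?case by auto
    next
      case (2 \<rho>)
      then have \<rho>: "refines A \<rho> (insert V \<pi>)" by simp
      then have p: "partition_on A \<rho>" and sat: "saturated V \<rho>"
        using refines_saturated[of A \<rho> "insert V \<pi>"] by (auto simp: refines_def)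
      have "\<exists>Y\<in>\<pi>. X \<subseteq> Y" if "X \<in> \<rho>" "\<not> X \<subseteq> V" for X
        using \<rho> that unfolding refines_def by blast
      then show ?case
        using partition_on_blocks_inside[OF p \<pi>(2) sat] partition_on_blocks_outside[OF p \<pi>(2) sat] \<pi>(1)
        by (simp add: refines_def)
    next
      case (3 x)
      obtain \<rho>1 \<rho>2 where x: "x = (\<rho>1, \<rho>2)" by (cases x)
      with 3 have p: "partition_on V \<rho>1" "partition_on (A - V) \<rho>2" by (auto simp: refines_def)
      show ?case
        using partition_on_disjoint_Un(2,3)[OF p V(1)] by (simp add: x)
    next
      case (4 x)
      obtain \<rho>1 \<rho>2 where x: "x = (\<rho>1, \<rho>2)" by (cases x)
      with 4 have p: "partition_on V \<rho>1" "partition_on (A - V) \<rho>2"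
        and r: "\<forall>X\<in>\<rho>2. \<exists>Y\<in>\<pi>. X \<subseteq> Y" by (auto simp: refines_def)
      have "\<forall>X\<in>\<rho>1. X \<subseteq> V" using partition_onD1[OF p(1)] by blast
      then show ?case
        using partition_on_disjoint_Un(1)[OF p V(1)] r insert.prems(2)
        unfolding x V(2) refines_def by auto
    next
      case (5 \<rho>)
      then have \<rho>: "refines A \<rho> (insert V \<pi>)" by simp
      then have "finite \<rho>"
        using insert.prems finite_elements unfolding refines_def by blast
      then have "(\<Prod>B\<in>{B\<in>\<rho>. B \<subseteq> V}. u (card B)) * (\<Prod>B\<in>{B\<in>\<rho>. \<not> B \<subseteq> V}. u (card B)) =
          (\<Prod>B\<in>{B\<in>\<rho>. B \<subseteq> V} \<union> {B\<in>\<rho>. \<not> B \<subseteq> V}. u (card B))"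
        by (intro prod.union_disjoint[symmetric]) auto
      also have "{B\<in>\<rho>. B \<subseteq> V} \<union> {B\<in>\<rho>. \<not> B \<subseteq> V} = \<rho>" by blast
      finally show ?case by simp
    qed
    also have "\<dots> = partition_sum (\<lambda>_. 1) u V * (\<Prod>W\<in>\<pi>. partition_sum (\<lambda>_. 1) u W)"
      unfolding insert.IH[OF fin(2) \<pi>(1), symmetric]
      by (simp add: partition_sum_def sum_product sum.cartesian_product[symmetric])
    finally show ?case using insert.hyps by simp
  qed
qed

text \<open>It suffices that the product formula sums to zero over the interval below
  \<open>\<pi>\<close> when \<open>\<pi>\<close> is not the bottom. That sum factorises over the
  blocks, and a block with at least two points gives the factor 0.\<close>

lemma moebius_partition_bot:
  assumes "partition_on {1..n} \<pi>"
  shows "moebius_partition n (bot_partition n) \<pi> = (\<Prod>V\<in>\<pi>. moebius_block (card V))"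
  using assms
proof (induction "card {\<rho>. refines {1..n} \<rho> \<pi>}" arbitrary: \<pi> rule: less_induct)
  case less
  let ?A = "{1..n}" and ?b = "bot_partition n"
  have fin: "finite {\<rho>. refines ?A \<rho> \<pi>}"
    by (rule finite_subset[OF _ finitely_many_partition_on[of ?A]]) (auto simp: refines_def)
  have bot: "refines ?A ?b \<rho>" if "partition_on ?A \<rho>" for \<rho>
    using that partition_on_singletons[of ?A] partition_onD1[OF that]
    unfolding refines_def bot_partition_def by auto
  show ?case
  proof (cases "?b = \<pi>")
    case True
    then have "(\<Prod>V\<in>\<pi>. moebius_block (card V)) = 1"
      by (intro prod.neutral) (auto simp: bot_partition_def moebius_block_def)
    then show ?thesis
      using True bot[OF less.prems] by (simp add: moebius_partition.simps)
  next
    case False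
    have "\<exists>V. V \<in> \<pi> \<and> card V > 1"
    proof (rule ccontr)
      assume "\<nexists>V. V \<in> \<pi> \<and> card V > 1"
      then have "card V \<le> 1" if "V \<in> \<pi>" for V using that by force
      moreover have "finite V" "V \<noteq> {}" if "V \<in> \<pi>" for V
        using partition_on_remove_block(2,3)[OF less.prems that] finite_subset[of V ?A] by auto
      ultimately have "\<exists>x. V = {x}" if "V \<in> \<pi>" for V
        using that by (metis card_1_singletonE card_gt_0_iff le_antisym less_eq_Suc_le One_nat_def)
      then have "refines ?A \<pi> ?b"
        using less.prems partition_on_singletons[of ?A] partition_onD1[OF less.prems]
        unfolding refines_def bot_partition_def by fastforce
      then show False using False bot[OF less.prems] refines_asym by blast
    qed
    then obtain V where V: "V \<in> \<pi>" "card V > 1" by blast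
    have "finite \<pi>" using less.prems finite_elements by blast
    have IH: "moebius_partition n ?b \<rho> = (\<Prod>V\<in>\<rho>. moebius_block (card V))"
      if \<rho>: "refines ?A \<rho> \<pi>" "\<rho> \<noteq> \<pi>" for \<rho>
    proof (rule less.hyps)
      have "\<pi> \<notin> {\<rho>'. refines ?A \<rho>' \<rho>}" using \<rho> refines_asym by blast
      moreover have "\<pi> \<in> {\<rho>'. refines ?A \<rho>' \<pi>}" using less.prems refines_refl by blast
      moreover have "{\<rho>'. refines ?A \<rho>' \<rho>} \<subseteq> {\<rho>'. refines ?A \<rho>' \<pi>}"
        using \<rho> refines_trans by blast
      ultimately show "card {\<rho>'. refines ?A \<rho>' \<rho>} < card {\<rho>'. refines ?A \<rho>' \<pi>}"
        using fin by (intro psubset_card_mono) auto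
    qed (use \<rho> in \<open>simp add: refines_def\<close>)
    \<comment> \<open>The bottom is below everything, so the defining recursion runs over all proper
      refinements of \<open>\<pi>\<close>.\<close>
    have eq: "{\<rho>. refines ?A ?b \<rho> \<and> refines ?A \<rho> \<pi> \<and> \<rho> \<noteq> \<pi>} = {\<rho>. refines ?A \<rho> \<pi>} - {\<pi>}"
      using bot by (auto simp: refines_def)
    have "moebius_partition n ?b \<pi> =
        - (\<Sum>\<rho>\<in>{\<rho>. refines ?A \<rho> \<pi>} - {\<pi>}. moebius_partition n ?b \<rho>)"
      using False bot[OF less.prems] by (subst moebius_partition.simps) (simp add: eq[simplified])
    also have "\<dots> = - (\<Sum>\<rho>\<in>{\<rho>. refines ?A \<rho> \<pi>} - {\<pi>}. \<Prod>V\<in>\<rho>. moebius_block (card V))"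
      using IH by simp
    also have "\<dots> = (\<Prod>V\<in>\<pi>. moebius_block (card V)) -
        (\<Sum>\<rho> | refines ?A \<rho> \<pi>. \<Prod>V\<in>\<rho>. moebius_block (card V))"
      using less.prems refines_refl by (subst sum.remove[OF fin, of \<pi>]) auto
    also have "(\<Sum>\<rho> | refines ?A \<rho> \<pi>. \<Prod>V\<in>\<rho>. moebius_block (card V)) =
        (\<Prod>V\<in>\<pi>. partition_sum (\<lambda>_. 1) moebius_block V)"
      using less.prems by (intro sum_refinements) auto
    also have "\<dots> = 0"
    proof (rule prod_zero)
      have "finite V" using V(2) card.infinite by fastforce
      then show "\<exists>V\<in>\<pi>. partition_sum (\<lambda>_. 1) moebius_block V = 0"
        using V by (intro bexI[of _ V]) (auto simp: partition_sum_eq_transform partition_transform_moebius_block)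
    qed fact
    finally show ?thesis by simp
  qed
qed

subsection \<open>Generating functions and Newton's identities\<close>

lemma partition_transform_cong:
  assumes "\<And>k. 1 \<le> k \<Longrightarrow> k \<le> n \<Longrightarrow> u k = v k"
  shows "partition_transform w u n = partition_transform w v n"
  using assms
proof (induction n arbitrary: w rule: less_induct)
  case (less n)
  show ?case
  proof (cases n)
    case (Suc m)
    have "partition_transform (\<lambda>k. w (Suc k)) u (m - k) = partition_transform (\<lambda>k. w (Suc k)) v (m - k)" for k
      by (rule less.IH) (use Suc less.prems in auto)
    then show ?thesis
      using less.prems Suc by (auto intro!: sum.cong)
  qed simp
qed

lemma partition_transform_uminus:
  fixes u :: "nat \<Rightarrow> 'b::comm_ring_1"
  shows "partition_transform (\<lambda>k. - w k) u n = - partition_transform w u n"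
proof (induction n arbitrary: w rule: less_induct)
  case (less n)
  show ?case
  proof (cases n)
    case (Suc m)
    have "partition_transform (\<lambda>k. - w (Suc k)) u (m - k) = - partition_transform (\<lambda>k. w (Suc k)) u (m - k)" for k
      by (rule less.IH) (use Suc in auto)
    then show ?thesis
      using Suc by (simp add: sum_negf)
  qed simp
qed

section \<open>Exponential generating functions and the partition logarithm\<close>

definition egf :: "(nat \<Rightarrow> 'b::field_char_0) \<Rightarrow> 'b fps" where
  "egf f = Abs_fps (\<lambda>n. f n / fact n)"

lemma egf_eq_iff: "egf f = egf g \<longleftrightarrow> f = g"
  by (auto simp: egf_def fps_eq_iff)

lemma egf_mult: "egf f * egf g = egf (\<lambda>n. \<Sum>k\<le>n. of_nat (n choose k) * (f k * g (n - k)))"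
proof (rule fps_ext)
  fix n
  have "(egf f * egf g) $ n = (\<Sum>k\<le>n. f k / fact k * (g (n - k) / fact (n - k)))"
    by (simp add: egf_def fps_mult_nth atLeast0AtMost)
  also have "\<dots> = (\<Sum>k\<le>n. of_nat (n choose k) * (f k * g (n - k)) / fact n)"
    by (intro sum.cong refl) (simp add: binomial_fact field_simps)
  finally show "(egf f * egf g) $ n = egf (\<lambda>n. \<Sum>k\<le>n. of_nat (n choose k) * (f k * g (n - k))) $ n"
    by (simp add: egf_def sum_divide_distrib)
qed

text \<open>The weight of \<open>\<pi>\<close> is the Moebius function from \<open>\<pi>\<close> to
  the top, so this is Moebius inversion of the sum over all partitions.\<close>

definition partition_log :: "(nat \<Rightarrow> 'b) \<Rightarrow> nat \<Rightarrow> 'b::field_char_0" where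
  "partition_log b = partition_transform (\<lambda>k. (-1) ^ (k - 1) * fact (k - 1)) b"

text \<open>With \<open>B\<close> the exponential generating function of \<open>b\<close>, that of \<^term>\<open>partition_log b\<close> is
  \<open>1 + log B\<close>; only its derivative \<open>B' / B\<close> matters. The sequence \<open>r\<close> in the proof has generating
  function \<open>1 / B\<close>.\<close>

lemma partition_transform_log:
  assumes "b 0 = 1"
  shows "partition_transform (\<lambda>_. 1) (partition_log b) n = b n"
proof -
  define w :: "nat \<Rightarrow> 'a" where "w k = (-1) ^ (k - 1) * fact (k - 1)" for k
  define r :: "nat \<Rightarrow> 'a" where "r = partition_transform (\<lambda>k. (-1) ^ k * fact k) b"
  have wr: "partition_transform (\<lambda>k. w (Suc k)) u = partition_transform (\<lambda>k. (-1) ^ k * fact k) u" for u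
    by (simp add: w_def)
  have "(\<Sum>k\<le>n. of_nat (n choose k) * (b k * r (n - k))) = (if n = 0 then 1 else 0)" for n
  proof (cases n)
    case 0
    then show ?thesis by (simp add: assms r_def)
  next
    case (Suc m)
    \<comment> \<open>Marking an arbitrary block asks for value 0 at 0; no transform notices the
      change.\<close>
    define b' where "b' = b(0 := 0)"
    have r': "partition_transform (\<lambda>k. w (Suc k)) b' = r"
      unfolding r_def wr by (intro ext partition_transform_cong) (simp add: b'_def)
    have "(\<Sum>k\<le>n. of_nat (n choose k) * (b' k * r (n - k))) =
        partition_transform (\<lambda>k. of_nat k * w k) b' n"
      using partition_transform_any_block[of b' w n] r' by (simp add: b'_def)
    \<comment> \<open>The two weights differ at 0, where they are 0 and -1, but \<open>n\<close> is
      positive and every partition has a block.\<close>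
    also have "\<dots> = partition_transform (\<lambda>k. - ((-1) ^ k * fact k)) b' n"
      unfolding Suc partition_transform.simps by (simp add: w_def mult_ac)
    also have "\<dots> = - r n"
      unfolding partition_transform_uminus r_def
      by (intro arg_cong[where f = uminus] partition_transform_cong) (simp add: b'_def)
    finally have "(\<Sum>k\<le>n. of_nat (n choose k) * (b' k * r (n - k))) = - r n" .
    moreover have "(\<Sum>k\<in>{..n} - {0}. of_nat (n choose k) * (b k * r (n - k))) =
        (\<Sum>k\<in>{..n} - {0}. of_nat (n choose k) * (b' k * r (n - k)))"
      by (intro sum.cong) (auto simp: b'_def)
    moreover have "b' 0 = 0" by (simp add: b'_def)
    moreover have split: "(\<Sum>k\<le>n. F k) = F 0 + (\<Sum>k\<in>{..n} - {0}. F k)" for F :: "nat \<Rightarrow> 'a"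
      by (rule sum.remove) auto
    \<comment> \<open>The term at 0 is \<open>b 0 * r n = r n\<close> and cancels the
      \<open>- r n\<close> found for \<open>b'\<close>.\<close>
    ultimately show ?thesis
      using Suc assms unfolding split by simp
  qed
  then have "egf b * egf r = egf (\<lambda>n. if n = 0 then 1 else 0)"
    unfolding egf_mult by simp
  also have "\<dots> = 1"
    by (simp add: egf_def fps_eq_iff)
  finally have inv: "egf b * egf r = 1" .
  \<comment> \<open>Shifting the index differentiates, so the recursion for
    \<open>partition_log\<close> reads L' = B' * (1 / B).\<close>
  have "egf (\<lambda>n. partition_log b (Suc n)) = egf (\<lambda>n. b (Suc n)) * egf r"
    unfolding egf_mult partition_log_def r_def by simp
  then have "egf (\<lambda>n. partition_log b (Suc n)) * egf b = egf (\<lambda>n. b (Suc n))"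
    using inv by (simp add: mult_ac)
  then have "b (Suc n) = (\<Sum>k\<le>n. of_nat (n choose k) * (partition_log b (Suc k) * b (n - k)))" for n
    unfolding egf_mult egf_eq_iff by metis
  then show ?thesis
    using assms by (intro partition_transform_unique)
qed

text \<open>The logarithmic derivative of each factor is minus a geometric series; multiplying by
  the product avoids division.\<close>

lemma fps_deriv_prod_linear:
  fixes M :: "complex multiset"
  defines "R \<equiv> \<lambda>M. \<Prod>x\<in>#M. 1 - fps_const x * fps_X"
  shows "fps_deriv (R M) = - (Abs_fps (\<lambda>k. \<Sum>x\<in>#M. x ^ Suc k) * R M)"
proof (induction M)
  case empty
  then show ?case by (simp add: R_def fps_eq_iff)
next
  case (add x M)
  have R: "R (add_mset x M) = (1 - fps_const x * fps_X) * R M"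
    by (simp add: R_def)
  have "Abs_fps (\<lambda>k. \<Sum>y\<in>#add_mset x M. y ^ Suc k) =
      Abs_fps (\<lambda>k. x ^ Suc k) + Abs_fps (\<lambda>k. \<Sum>y\<in>#M. y ^ Suc k)"
    by (simp add: fps_eq_iff)
  moreover have geo: "Abs_fps (\<lambda>k. x ^ Suc k) * (1 - fps_const x * fps_X) = fps_const x"
    (is "?g * _ = _")
  proof (rule fps_ext)
    fix n
    have "?g * (1 - fps_const x * fps_X) = ?g - fps_const x * (?g * fps_X)"
      by (simp add: algebra_simps)
    then show "(?g * (1 - fps_const x * fps_X)) $ n = fps_const x $ n"
      by (cases n) simp_all
  qed
  ultimately have "Abs_fps (\<lambda>k. \<Sum>y\<in>#add_mset x M. y ^ Suc k) * R (add_mset x M) =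
      fps_const x * R M + (1 - fps_const x * fps_X) * (Abs_fps (\<lambda>k. \<Sum>y\<in>#M. y ^ Suc k) * R M)"
    unfolding R by (simp add: distrib_right mult.assoc[symmetric])
  then show ?case
    unfolding R using add.IH by (simp add: algebra_simps)
qed

text \<open>The reflected polynomial of a monic \<open>p\<close> is the product of the factors 1 - x
  X over the roots; its logarithmic derivative is compared at X^n. This covers indices beyond the
  degree too.\<close>

lemma newton_identity:
  fixes p :: "complex poly"
  assumes "lead_coeff p = 1"
  shows "of_nat (Suc n) * coeff (reflect_poly p) (Suc n) =
    - (\<Sum>k\<le>n. (\<Sum>x\<in>#proots p. x ^ Suc k) * coeff (reflect_poly p) (n - k))"
proof -
  have "fps_of_poly (reflect_poly (\<Prod>x\<in>#M. [:-x, 1:])) = (\<Prod>x\<in>#M. 1 - fps_const x * fps_X)"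
    for M :: "complex multiset"
  proof (induction M)
    case (add x M)
    have "reflect_poly [:-x, 1:] = [:1, -x:]"
      by (simp add: reflect_poly_def)
    then show ?case
      using add by (simp add: reflect_poly_mult fps_of_poly_mult fps_of_poly_linear'
          del: mult_pCons_left)
  qed simp
  from this[of "proots p"] have "fps_of_poly (reflect_poly p) = (\<Prod>x\<in>#proots p. 1 - fps_const x * fps_X)"
    using complex_poly_decompose_multiset[of p] assms by simp
  then have "fps_deriv (fps_of_poly (reflect_poly p)) $ n =
      (- (Abs_fps (\<lambda>k. \<Sum>x\<in>#proots p. x ^ Suc k) * fps_of_poly (reflect_poly p))) $ n"
    using fps_deriv_prod_linear by simp
  then show ?thesis
    by (simp add: fps_mult_nth atLeast0AtMost)
qed

text \<open>Newton's identity times (-1)^(n+1) n! is exactly the recursion of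
  \<open>partition_transform_unique\<close>.\<close>

lemma partition_transform_moments:
  fixes p :: "complex poly"
  assumes "lead_coeff p = 1"
  shows "partition_transform (\<lambda>_. 1) (\<lambda>k. (-1) ^ (k - 1) * fact (k - 1) * (\<Sum>x\<in>#proots p. x ^ k)) n =
    fact n * ((-1) ^ n * coeff (reflect_poly p) n)"
proof (rule partition_transform_unique)
  fix n :: nat
  let ?r = "coeff (reflect_poly p)" and ?P = "\<lambda>k. \<Sum>x\<in>#proots p. x ^ k"
  have "fact (Suc n) * ((-1) ^ Suc n * ?r (Suc n)) = - ((-1) ^ n * fact n) * (of_nat (Suc n) * ?r (Suc n))"
    by (simp add: algebra_simps)
  also have "\<dots> = (\<Sum>k\<le>n. (-1) ^ n * fact n * (?P (Suc k) * ?r (n - k)))"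
    unfolding newton_identity[OF assms] minus_mult_minus sum_distrib_left by simp
  also have "\<dots> = (\<Sum>k\<le>n. of_nat (n choose k) *
      ((-1) ^ (Suc k - 1) * fact (Suc k - 1) * ?P (Suc k) * (fact (n - k) * ((-1) ^ (n - k) * ?r (n - k)))))"
  proof (intro sum.cong refl)
    fix k assume "k \<in> {..n}"
    then have "k \<le> n" by simp
    then have "(-1 :: complex) ^ n = (-1) ^ k * (-1) ^ (n - k)"
      "(fact n :: complex) = of_nat (n choose k) * fact k * fact (n - k)"
      by (simp_all add: power_add[symmetric] binomial_fact)
    then show "(-1) ^ n * fact n * (?P (Suc k) * ?r (n - k)) = of_nat (n choose k) *
      ((-1) ^ (Suc k - 1) * fact (Suc k - 1) * ?P (Suc k) * (fact (n - k) * ((-1) ^ (n - k) * ?r (n - k))))"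
      by simp
  qed
  finally show "fact (Suc n) * ((-1) ^ Suc n * ?r (Suc n)) = (\<Sum>k\<le>n. of_nat (n choose k) *
      ((-1) ^ (Suc k - 1) * fact (Suc k - 1) * ?P (Suc k) * (fact (n - k) * ((-1) ^ (n - k) * ?r (n - k)))))" .
qed (simp add: assms)

subsection \<open>Finite free cumulants\<close>

text \<open>The normalisation that turns the convolution into a pointwise product for
  \<open>k \<le> d\<close>; beyond \<open>d\<close> the divisor, and hence the value, is 0.\<close>

definition norm_esym :: "nat \<Rightarrow> complex poly \<Rightarrow> nat \<Rightarrow> complex" where
  "norm_esym d p k = esym_coeff d p k / of_nat (d choose k)"

lemma falling_factorial_eq:
  assumes "k \<le> d"
  shows "falling_factorial d k = (d choose k) * fact k"
  using assms
proof (induction k)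
  case (Suc k)
  have "falling_factorial d (Suc k) = (d - k) * (d choose k) * fact k"
    using Suc by (simp add: falling_factorial_def)
  also have "(d - k) * (d choose k) = Suc k * (d choose Suc k)"
    by (simp only: binomial_absorption binomial_absorb_comp)
  finally show ?case by (simp add: algebra_simps)
qed (simp add: falling_factorial_def)

lemma norm_esym_0: "lead_coeff p = 1 \<Longrightarrow> degree p = d \<Longrightarrow> norm_esym d p 0 = 1"
  by (auto simp: norm_esym_def esym_coeff_def)

lemma partition_block_card:
  assumes "partition_on {1..n} \<pi>" "V \<in> \<pi>"
  shows "1 \<le> card V" "card V \<le> n"
proof -
  have "V \<subseteq> {1..n}" "V \<noteq> {}"
    using partition_on_remove_block(2,3)[OF assms] by auto
  then show "1 \<le> card V" "card V \<le> n"
    using card_mono[of "{1..n}" V] finite_subset[of V "{1..n}"] card_gt_0_iff[of V] by auto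
qed

lemma partition_sum_card_blocks:
  assumes "partition_on {1..n} \<pi>"
  shows "(\<Sum>V\<in>\<pi>. card V) = n"
proof -
  have "finite V" if "V \<in> \<pi>" for V
    using partition_on_remove_block(2)[OF assms that] finite_subset by blast
  from product_partition[OF assms this] show ?thesis by simp
qed

text \<open>Each (d)_k is k! times a binomial, so the summand is minus the logarithm's weight times
  normalised coefficients. The factor \<open>moebius_block n\<close> cancels the sign and (n-1)! of
  the prefactor.\<close>

lemma finite_free_cumulant_eq_log:
  assumes "1 \<le> n" "n \<le> d"
  shows "of_nat d * of_int (moebius_block n) * finite_free_cumulant d p n =
    of_nat d ^ n * partition_log (norm_esym d p) n"
proof -
  have "(-1) ^ card \<pi> * (mult_ext fact \<pi> * mult_ext (esym_coeff d p) \<pi> * fact (card \<pi> - 1)) /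
        of_nat (mult_ext (falling_factorial d) \<pi>) =
      - ((-1) ^ (card \<pi> - 1) * fact (card \<pi> - 1) * (\<Prod>V\<in>\<pi>. norm_esym d p (card V)))"
    if \<pi>: "partition_on {1..n} \<pi>" for \<pi>
  proof -
    have "finite \<pi>" using \<pi> finite_elements by blast
    moreover have "\<pi> \<noteq> {}" using \<pi> assms by (auto simp: partition_on_def)
    ultimately have "card \<pi> > 0" by (simp add: card_gt_0_iff)
    \<comment> \<open>Nonemptiness of \<open>\<pi>\<close> makes the truncated
      \<open>card \<pi> - 1\<close> a true predecessor.\<close>
    then have sign: "(-1 :: complex) ^ card \<pi> = - ((-1) ^ (card \<pi> - 1))"
      by (cases "card \<pi>") auto
    have weight: "mult_ext fact \<pi> * mult_ext (esym_coeff d p) \<pi> / of_nat (mult_ext (falling_factorial d) \<pi>) =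
        (\<Prod>V\<in>\<pi>. norm_esym d p (card V))"
      unfolding mult_ext_def of_nat_prod prod.distrib[symmetric] prod_dividef[symmetric]
    proof (intro prod.cong refl)
      fix V assume "V \<in> \<pi>"
      then have "card V \<le> d" using partition_block_card[OF \<pi>] assms by fastforce
      then show "fact (card V) * esym_coeff d p (card V) / of_nat (falling_factorial d (card V)) =
          norm_esym d p (card V)"
        by (simp add: falling_factorial_eq norm_esym_def)
    qed
    have "(-1) ^ card \<pi> * (mult_ext fact \<pi> * mult_ext (esym_coeff d p) \<pi> * fact (card \<pi> - 1)) /
        of_nat (mult_ext (falling_factorial d) \<pi>) = (-1) ^ card \<pi> * fact (card \<pi> - 1) *
        (mult_ext fact \<pi> * mult_ext (esym_coeff d p) \<pi> / of_nat (mult_ext (falling_factorial d) \<pi>))"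
      by simp
    then show ?thesis
      unfolding weight sign by simp
  qed
  then have "finite_free_cumulant d p n = (- of_nat d) ^ n / (of_nat d * fact (n - 1)) *
      (\<Sum>\<pi> | partition_on {1..n} \<pi>. - ((-1) ^ (card \<pi> - 1) * fact (card \<pi> - 1) *
         (\<Prod>V\<in>\<pi>. norm_esym d p (card V))))"
    unfolding finite_free_cumulant_def set_partitions_def
    by (intro arg_cong[where f = "(*) _"] sum.cong refl) simp
  also have "\<dots> = - ((- of_nat d) ^ n / (of_nat d * fact (n - 1))) * partition_log (norm_esym d p) n"
    using partition_sum_eq_transform[of "{1..n}" "\<lambda>k. (-1) ^ (k - 1) * fact (k - 1)" "norm_esym d p"]
    by (simp add: partition_log_def partition_sum_def sum_negf)
  also have "(- of_nat d :: complex) ^ n = - ((-1) ^ (n - 1)) * of_nat d ^ n"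
    using assms by (cases n) (simp_all add: power_minus[of "of_nat d"])
  finally have "finite_free_cumulant d p n =
      (-1) ^ (n - 1) * of_nat d ^ n / (of_nat d * fact (n - 1)) * partition_log (norm_esym d p) n"
    by simp
  moreover have "(-1 :: complex) ^ (n - 1) * (-1) ^ (n - 1) = 1"
    by (simp flip: power_mult_distrib)
  ultimately show ?thesis
    using assms by (simp add: moebius_block_def)
qed

section \<open>The convolution in terms of coefficients\<close>

lemma esym_coeff_finite_free_mult:
  assumes "k \<le> d"
  shows "esym_coeff d (finite_free_mult d p q) k = esym_coeff d p k * esym_coeff d q k / of_nat (d choose k)"
proof -
  have "coeff (finite_free_mult d p q) (d - k) =
      (\<Sum>j\<le>d. if j = k then (-1) ^ j * (esym_coeff d p j * esym_coeff d q j / of_nat (d choose j)) else 0)"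
    unfolding finite_free_mult_def coeff_sum coeff_monom using assms by (intro sum.cong) auto
  also have "\<dots> = (-1) ^ k * (esym_coeff d p k * esym_coeff d q k / of_nat (d choose k))"
    using assms by simp
  finally show ?thesis
    by (simp add: esym_coeff_def[of d "finite_free_mult d p q"] power_add[symmetric] mult.assoc[symmetric])
qed

lemma norm_esym_finite_free_mult:
  assumes "k \<le> d"
  shows "norm_esym d (finite_free_mult d p q) k = norm_esym d p k * norm_esym d q k"
  using assms by (simp add: norm_esym_def esym_coeff_finite_free_mult)

lemma finite_free_mult_monic:
  assumes "lead_coeff p = 1" "degree p = d" "lead_coeff q = 1" "degree q = d"
  shows "lead_coeff (finite_free_mult d p q) = 1" "degree (finite_free_mult d p q) = d"
proof -
  have "degree (finite_free_mult d p q) \<le> d"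
    unfolding finite_free_mult_def
    by (intro degree_sum_le) (auto intro: order_trans[OF degree_monom_le])
  moreover have lead: "coeff (finite_free_mult d p q) d = 1"
    using esym_coeff_finite_free_mult[of 0 d p q] assms by (auto simp: esym_coeff_def)
  ultimately show "degree (finite_free_mult d p q) = d"
    by (simp add: le_degree order_antisym)
  with lead show "lead_coeff (finite_free_mult d p q) = 1" by simp
qed

text \<open>The factor d undoes the averaging in the moment, and for \<open>n \<le> d\<close> the
  reflected coefficient is the one read by \<open>esym_coeff\<close>.\<close>

lemma partition_transform_moment:
  assumes "lead_coeff p = 1" "degree p = d" "d \<ge> 1" "n \<le> d"
  shows "partition_transform (\<lambda>_. 1) (\<lambda>k. of_nat d * of_int (moebius_block k) * moment d p k) n =
    fact n * esym_coeff d p n"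
proof -
  have "(\<lambda>k. of_nat d * of_int (moebius_block k) * moment d p k) =
      (\<lambda>k. (-1) ^ (k - 1) * fact (k - 1) * (\<Sum>x\<in>#proots p. x ^ k))"
    using assms by (simp add: moment_def moebius_block_def mult.assoc)
  moreover have "coeff (reflect_poly p) n = coeff p (d - n)"
    using assms by (simp add: coeff_reflect_poly)
  ultimately show ?thesis
    using partition_transform_moments[OF assms(1), of n] by (simp add: esym_coeff_def)
qed

section \<open>Absorbing powers of d and Moebius factors into sequences\<close>

lemma scaled_mult_ext:
  fixes u :: "nat \<Rightarrow> complex"
  assumes "partition_on {1..n} \<sigma>"
  shows "of_nat d ^ card \<sigma> * of_int (moebius_partition n (bot_partition n) \<sigma>) * mult_ext u \<sigma> =
    (\<Prod>V\<in>\<sigma>. of_nat d * of_int (moebius_block (card V)) * u (card V))"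
  by (simp add: moebius_partition_bot[OF assms] mult_ext_def prod.distrib)

text \<open>The power of d and the Moebius factor of a partition are both products over its blocks,
  so they merge into the two sequences.\<close>

lemma sum_join_top_eq_connected_sum:
  fixes u v :: "nat \<Rightarrow> complex"
  assumes "1 \<le> n"
  shows "(\<Sum>(\<sigma>, \<tau>) \<in> {(\<sigma>, \<tau>). \<sigma> \<in> set_partitions n \<and> \<tau> \<in> set_partitions n \<and>
                                 partition_join n \<sigma> \<tau> = top_partition n}.
              of_nat d ^ (card \<sigma> + card \<tau>) *
              of_int (moebius_partition n (bot_partition n) \<sigma>) *
              of_int (moebius_partition n (bot_partition n) \<tau>) *
              mult_ext u \<sigma> * mult_ext v \<tau>) =
    connected_sum (\<lambda>k. of_nat d * of_int (moebius_block k) * u k)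
      (\<lambda>k. of_nat d * of_int (moebius_block k) * v k) {1..n}"
proof -
  have "of_nat d ^ (card \<sigma> + card \<tau>) *
        of_int (moebius_partition n (bot_partition n) \<sigma>) *
        of_int (moebius_partition n (bot_partition n) \<tau>) * mult_ext u \<sigma> * mult_ext v \<tau> =
      pair_weight (\<lambda>k. of_nat d * of_int (moebius_block k) * u k)
        (\<lambda>k. of_nat d * of_int (moebius_block k) * v k) (\<sigma>, \<tau>)"
    if "partition_on {1..n} \<sigma>" "partition_on {1..n} \<tau>" for \<sigma> \<tau>
    unfolding pair_weight_def fst_conv snd_conv scaled_mult_ext[OF that(1), symmetric]
      scaled_mult_ext[OF that(2), symmetric]
    by (simp add: power_add mult_ac)
  moreover have "{(\<sigma>, \<tau>). \<sigma> \<in> set_partitions n \<and> \<tau> \<in> set_partitions n \<and>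
        partition_join n \<sigma> \<tau> = top_partition n} =
      {st. partition_on {1..n} (fst st) \<and> partition_on {1..n} (snd st) \<and>
        connected_pair {1..n} (fst st) (snd st)}"
    using connected_pair_iff_join_top[OF _ _ assms, unfolded set_partitions_def mem_Collect_eq]
    by (intro set_eqI) (simp add: case_prod_unfold set_partitions_def cong: conj_cong)
  ultimately show ?thesis
    unfolding connected_sum_def by (auto intro!: sum.cong)
qed

text \<open>The block sizes add up to \<open>n\<close>, so \<open>c\<close> is collected
  \<open>n\<close> times.\<close>

lemma connected_sum_scale:
  fixes f g :: "nat \<Rightarrow> complex"
  shows "connected_sum (\<lambda>k. c ^ k * f k) g {1..n} = c ^ n * connected_sum f g {1..n}"
proof -
  have "pair_weight (\<lambda>k. c ^ k * f k) g st = c ^ n * pair_weight f g st"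
    if "partition_on {1..n} (fst st)" for st
    unfolding pair_weight_def
    by (simp add: prod.distrib power_sum[symmetric] partition_sum_card_blocks[OF that] mult_ac)
  then show ?thesis
    unfolding connected_sum_def sum_distrib_left by (intro sum.cong) auto
qed

lemma connected_sum_scale_right:
  fixes f g :: "nat \<Rightarrow> complex"
  shows "connected_sum f (\<lambda>k. c ^ k * g k) {1..n} = c ^ n * connected_sum f g {1..n}"
proof -
  have "pair_weight f (\<lambda>k. c ^ k * g k) st = c ^ n * pair_weight f g st"
    if "partition_on {1..n} (snd st)" for st
    unfolding pair_weight_def
    by (simp add: prod.distrib power_sum[symmetric] partition_sum_card_blocks[OF that] mult_ac)
  then show ?thesis
    unfolding connected_sum_def sum_distrib_left by (intro sum.cong) auto
qed

lemma connected_sum_cong: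
  assumes "\<And>k. 1 \<le> k \<Longrightarrow> k \<le> n \<Longrightarrow> f k = f' k" "\<And>k. 1 \<le> k \<Longrightarrow> k \<le> n \<Longrightarrow> g k = g' k"
  shows "connected_sum f g {1..n} = connected_sum f' g' {1..n}"
  unfolding connected_sum_def pair_weight_def
  using assms partition_block_card
  by (intro sum.cong refl arg_cong2[where f = "(*)"] prod.cong) auto

theorem theorem1p1:
  fixes d n :: nat and p q :: "complex poly"
  assumes "d \<ge> 1"
    and "lead_coeff p = 1" and "degree p = d"
    and "lead_coeff q = 1" and "degree q = d"
    and "1 \<le> n" and "n \<le> d"
  shows "(finite_free_cumulant d (finite_free_mult d p q) n =
           (-1) ^ (n - 1) / (of_nat d ^ (n + 1) * fact (n - 1)) *
           (\<Sum>(\<sigma>, \<tau>) \<in> {(\<sigma>, \<tau>). \<sigma> \<in> set_partitions n \<and> \<tau> \<in> set_partitions n \<and>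
                                 partition_join n \<sigma> \<tau> = top_partition n}.
              of_nat d ^ (card \<sigma> + card \<tau>) *
              of_int (moebius_partition n (bot_partition n) \<sigma>) *
              of_int (moebius_partition n (bot_partition n) \<tau>) *
              mult_ext (finite_free_cumulant d p) \<sigma> *
              mult_ext (finite_free_cumulant d q) \<tau>))
    \<and> (moment d (finite_free_mult d p q) n =
           (-1) ^ (n - 1) / (of_nat d ^ (n + 1) * fact (n - 1)) *
           (\<Sum>(\<sigma>, \<tau>) \<in> {(\<sigma>, \<tau>). \<sigma> \<in> set_partitions n \<and> \<tau> \<in> set_partitions n \<and>
                                 partition_join n \<sigma> \<tau> = top_partition n}.
              of_nat d ^ (card \<sigma> + card \<tau>) *
              of_int (moebius_partition n (bot_partition n) \<sigma>) *
              of_int (moebius_partition n (bot_partition n) \<tau>) *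
              mult_ext (finite_free_cumulant d p) \<sigma> *
              mult_ext (moment d q) \<tau>))"
proof -
  let ?D = "of_nat d :: complex" and ?r = "finite_free_mult d p q"
  let ?L = "\<lambda>p. partition_log (norm_esym d p)"
  let ?K = "\<lambda>p k. ?D * of_int (moebius_block k) * finite_free_cumulant d p k"
  let ?M = "\<lambda>p k. ?D * of_int (moebius_block k) * moment d p k"
  note r = finite_free_mult_monic[OF assms(2-5)]
  have E_L: "partition_transform (\<lambda>_. 1) (?L p') m = norm_esym d p' m"
    if "lead_coeff p' = 1" "degree p' = d" for p' m
    by (rule partition_transform_log) (rule norm_esym_0[OF that])
  have card: "card {1..n} = n" "finite {1..n}" "{1..n} \<noteq> {}" "card {1..n} \<le> n"
    using assms(6) by auto
  have K: "?K p' k = ?D ^ k * ?L p' k" if "1 \<le> k" "k \<le> n" for p' k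
    using finite_free_cumulant_eq_log[of k d p'] that assms(7) by simp
  \<comment> \<open>The prefactor of the theorem is the inverse of
    \<open>?D ^ n * ?D * of_int (moebius_block n)\<close>.\<close>
  have scale: "(-1) ^ (n - 1) / (?D ^ (n + 1) * fact (n - 1)) * (?D ^ n * (?D * of_int (moebius_block n) * x)) = x" for x
    using assms(1) by (simp add: moebius_block_def field_simps power_add[symmetric])

  have "connected_sum (?K p) (?K q) {1..n} =
      connected_sum (\<lambda>k. ?D ^ k * ?L p k) (\<lambda>k. ?D ^ k * ?L q k) {1..n}"
    using K by (intro connected_sum_cong) auto
  also have "\<dots> = ?D ^ n * (?D ^ n * connected_sum (?L p) (?L q) {1..n})"
    unfolding connected_sum_scale connected_sum_scale_right ..
  \<comment> \<open>The product hypothesis is the multiplicativity of \<open>norm_esym\<close> under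
    the convolution.\<close>
  also have "connected_sum (?L p) (?L q) {1..n} = ?L ?r (card {1..n})"
  proof (intro connected_sum_eq[where n = n] card)
    fix m assume "m \<le> n"
    then show "partition_transform (\<lambda>_. 1) (?L ?r) m =
        partition_transform (\<lambda>_. 1) (?L p) m * partition_transform (\<lambda>_. 1) (?L q) m"
      using assms(7) unfolding E_L[OF assms(2,3)] E_L[OF assms(4,5)] E_L[OF r]
      by (intro norm_esym_finite_free_mult) simp
  qed
  \<comment> \<open>One of the two powers \<open>?D ^ n\<close> turns the logarithm back into a
    cumulant; the other is left for \<open>scale\<close>.\<close>
  also have "?D ^ n * ?L ?r (card {1..n}) = ?K ?r n"
    using K[of n ?r] assms(6) card(1) by simp
  finally have cumulants: "connected_sum (?K p) (?K q) {1..n} = ?D ^ n * ?K ?r n" .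

  have "connected_sum (?K p) (?M q) {1..n} = connected_sum (\<lambda>k. ?D ^ k * ?L p k) (?M q) {1..n}"
    using K by (intro connected_sum_cong) auto
  also have "\<dots> = ?D ^ n * connected_sum (?L p) (?M q) {1..n}"
    by (rule connected_sum_scale)
  \<comment> \<open>Only \<open>p\<close> passes through the logarithm. The product hypothesis holds
    because m! times a coefficient of the convolution is the normalised coefficient of
    \<open>p\<close> times m! times that of \<open>q\<close>.\<close>
  also have "connected_sum (?L p) (?M q) {1..n} = ?M ?r (card {1..n})"
  proof (intro connected_sum_eq[where n = n] card)
    fix m assume "m \<le> n"
    then have "m \<le> d" using assms(7) by simp
    then show "partition_transform (\<lambda>_. 1) (?M ?r) m =
        partition_transform (\<lambda>_. 1) (?L p) m * partition_transform (\<lambda>_. 1) (?M q) m"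
      unfolding E_L[OF assms(2,3)] partition_transform_moment[OF assms(4,5,1) \<open>m \<le> d\<close>]
        partition_transform_moment[OF r assms(1) \<open>m \<le> d\<close>]
      by (simp add: norm_esym_def esym_coeff_finite_free_mult)
  qed
  finally have moments: "connected_sum (?K p) (?M q) {1..n} = ?D ^ n * ?M ?r n"
    unfolding card(1) .

  show ?thesis
    unfolding sum_join_top_eq_connected_sum[OF assms(6)] cumulants moments scale by simp
qed

end
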